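(* Let $C>0$ and $0<p<1/6$. There exist finite point sets $X_n\subset\overline{B_{1/2}(0)}\subset\mathbb R^3$ with $s_n:=|X_n|\to\infty$, and wavenumbers $\kappa_n>0$, such that $$\kappa_n\delta_{X_n}=Cs_n^p\quad\text{for all }n,$$ but $$\lambda_{\min}(G_{X_n})\longrightarrow0 ,$$ where $G_{X_n}$ is the spherical Gram matrix of $X_n$ with wavenumber $\kappa_n$.
   Context: For a finite set $X=\{x_1,\dots,x_s\}\subset\mathbb R^3$ of distinct points and a wavenumber $\kappa>0$: $\delta_X=\min_{j\ne k}|x_j-x_k|$, and $G_X=[K_\kappa(x_j-x_k)]_{j,k=1}^s$ with $K_\kappa(h)=\frac1{4\pi}\int_{\mathbb S^2}e^{i\kappa\omega\cdot h}d\omega=\frac{\sin(\kappa|h|)}{\kappa|h|}$, $K_\kappa(0)=1$. *)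

theory Defs
  imports "HOL-Analysis.Analysis" "Jordan_Normal_Form.Spectral_Radius"
begin

text \<open>The mean of \<open>exp (\<i> * \<kappa> * (\<omega> \<bullet> h))\<close> over the unit sphere of \<open>\<real>\<^sup>3\<close>
  (normalised surface measure), in closed form.\<close>

definition spherical_kernel :: "real \<Rightarrow> real ^ 3 \<Rightarrow> real" where
  "spherical_kernel \<kappa> h = (if h = 0 then 1 else sin (\<kappa> * norm h) / (\<kappa> * norm h))"

text \<open>Meaningful only for finite sets with at least two points.\<close>

definition separation :: "(real ^ 3) set \<Rightarrow> real" where
  "separation X = Min {norm (x - y) | x y. x \<in> X \<and> y \<in> X \<and> x \<noteq> y}"

text \<open>A finite point set is given by a list enumerating it without repetition; another
  enumeration conjugates the Gram matrix by a permutation and leaves its spectrum unchanged.\<close>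

definition spherical_gram :: "real \<Rightarrow> (real ^ 3) list \<Rightarrow> real mat" where
  "spherical_gram \<kappa> xs =
     mat (length xs) (length xs) (\<lambda>(j, k). spherical_kernel \<kappa> (xs ! j - xs ! k))"

text \<open>Intended for real symmetric matrices of positive dimension, whose real spectrum is finite
  and nonempty.\<close>

definition lambda_min :: "real mat \<Rightarrow> real" where
  "lambda_min A = Min (spectrum A)"

end

theory Submission
  imports Defs "HOL-Real_Asymp.Real_Asymp"
begin

text \<open>
  The points are the cubic grid \<open>h \<cdot> {0, \<dots>, m - 1}\<^sup>3\<close>, so that \<open>s = m\<^sup>3\<close> and \<open>R = \<kappa> h = C m\<^bsup>3 p\<^esup>\<close>. The
  kernel is the Fourier transform of the uniform measure on the sphere of radius \<open>\<kappa>\<close>, so the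
  quadratic form of the Gram matrix at \<open>c\<close> is the spherical mean of the square of a trigonometric
  polynomial, which is periodic with respect to the lattice \<open>(2 \<pi> / h) \<int>\<^sup>3\<close>. Squared norms of points
  of \<open>\<int>\<^sup>3\<close> are integers, so if \<open>(R / 2 \<pi>)\<^sup>2\<close> stays away from the integers, the sphere
  stays at distance of order \<open>1 / (R h)\<close> from this lattice, whereas a trigonometric polynomial on the
  grid can be concentrated within distance of order \<open>1 / (m h)\<close> of it. As \<open>3 p < 1/2\<close>, a product
  of fourth powers of Dirichlet kernels has a Rayleigh quotient tending to \<open>0\<close>. Because \<open>6 p < 1\<close>,
  the increments of \<open>(R / 2 \<pi>)\<^sup>2\<close> in \<open>m\<close> tend to \<open>0\<close>, hence it avoids the integers for
  infinitely many \<open>m\<close>.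
\<close>

no_notation vec_index (infixl \<open>$\<close> 100)
no_notation scalar_prod (infix \<open>\<bullet>\<close> 70)

subsection \<open>Fourier integrals over balls\<close>

text \<open>Boxes determine Lebesgue measure, and the preimage of a box is its image under the
  inverse, which is again orthogonal and therefore preserves volume. It serves to rotate a frequency
  vector onto the first axis.\<close>

lemma lborel_distr_orthogonal:
  fixes T :: "real ^ 'n::{finite,wellorder} \<Rightarrow> real ^ 'n::_"
  assumes T: "orthogonal_transformation T"
  shows "distr lborel borel T = lborel"
proof (rule lborel_eqI[symmetric])
  fix l u :: "real ^ 'n::{finite,wellorder}"
  assume lu: "\<And>b. b \<in> Basis \<Longrightarrow> l \<bullet> b \<le> u \<bullet> b"
  have bij: "bij T" and inv: "orthogonal_transformation (inv_into UNIV T)"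
    using T by (simp_all add: orthogonal_transformation_bij orthogonal_transformation_inv)
  have meas: "T \<in> borel_measurable borel"
    using T by (intro borel_measurable_continuous_onI linear_continuous_on
        linear_conv_bounded_linear[THEN iffD1] orthogonal_transformation_linear)
  have eq: "T -` box l u = inv_into UNIV T ` box l u"
    using bij by (simp add: bij_vimage_eq_inv_image)
  have img: "inv_into UNIV T ` box l u \<in> lmeasurable"
    by (rule measurable_orthogonal_image[OF inv]) simp
  have sets: "T -` box l u \<in> sets borel"
    using measurable_sets[OF meas, of "box l u"] by simp
  have "emeasure (distr lborel borel T) (box l u) = emeasure lborel (T -` box l u)"
    using meas by (subst emeasure_distr) auto
  also have "\<dots> = emeasure lebesgue (T -` box l u)"
    using sets by simp
  also have "\<dots> = ennreal (measure lebesgue (inv_into UNIV T ` box l u))"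
    using img eq by (simp add: emeasure_eq_measure2 fmeasurableD2)
  also have "\<dots> = ennreal (measure lebesgue (box l u))"
    by (subst measure_orthogonal_image[OF inv]) auto
  also have "\<dots> = (\<Prod>b\<in>Basis. (u - l) \<bullet> b)"
    using lu by (simp add: emeasure_eq_ennreal_measure[symmetric])
  finally show "emeasure (distr lborel borel T) (box l u) = (\<Prod>b\<in>Basis. (u - l) \<bullet> b)" .
qed simp

lemma prod_Basis_cart:
  fixes x :: "real ^ 'n"
  shows "(\<Prod>b\<in>Basis. x \<bullet> b) = (\<Prod>i\<in>UNIV. x $ i)"
proof -
  have "(Basis :: (real ^ 'n) set) = range (\<lambda>i. axis i 1)"
    by (auto simp: Basis_vec_def)
  moreover have "inj (\<lambda>i. axis i 1 :: real ^ 'n)"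
    by (auto simp: inj_def axis_eq_axis)
  ultimately show ?thesis
    by (subst \<open>Basis = _\<close>, subst prod.reindex) (simp_all add: inner_axis)
qed

text \<open>Lets Fubini slice three-dimensional integrals into a line times a plane: the preimage of
  a box is a product of boxes, so both measures agree on boxes.\<close>

lemma lborel_distr_prod_vec3:
  "distr (lborel :: (real \<times> (real ^ 2)) measure) borel (\<lambda>(t, y). vector [t, y $ 1, y $ 2] :: real ^ 3) = lborel"
    (is "distr _ _ ?f = _")
proof (rule lborel_eqI[symmetric])
  fix l u :: "real ^ 3"
  assume lu: "\<And>b. b \<in> Basis \<Longrightarrow> l \<bullet> b \<le> u \<bullet> b"
  have le: "l $ i \<le> u $ i" for i
    using lu[of "axis i 1"] by (simp add: inner_axis axis_in_Basis_iff)
  have "linear ?f"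
    by (intro linearI) (auto simp: Finite_Cartesian_Product.vec_eq_iff forall_3)
  then have "continuous_on UNIV ?f"
    by (intro linear_continuous_on) (simp add: linear_conv_bounded_linear)
  then have meas: "?f \<in> borel_measurable borel"
    by (rule borel_measurable_continuous_onI)
  have box_Pair: "box (a, b) (c, d) = box a c \<times> box b d" for a c :: real and b d :: "real ^ 2"
    by (fastforce simp: box_def Basis_prod_def)
  have eq: "?f -` box l u = box (l $ 1, vector [l $ 2, l $ 3]) (u $ 1, vector [u $ 2, u $ 3])"
    by (auto simp: box_Pair mem_box_cart forall_3 forall_2)
  have le': "vector [l $ 2, l $ 3] $ i \<le> (vector [u $ 2, u $ 3] :: real ^ 2) $ i" for i
    using le exhaust_2[of i] by auto
  have "emeasure (distr lborel borel ?f) (box l u) = emeasure lborel (?f -` box l u)"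
    using meas by (subst emeasure_distr) auto
  also have "\<dots> = emeasure lborel (box (l $ 1) (u $ 1))
      * emeasure lborel (box (vector [l $ 2, l $ 3]) (vector [u $ 2, u $ 3] :: real ^ 2))"
    unfolding eq box_Pair lborel_prod[symmetric]
    by (rule lborel.emeasure_pair_measure_Times) auto
  also have "\<dots> = ennreal (u $ 1 - l $ 1) * ennreal ((u $ 2 - l $ 2) * (u $ 3 - l $ 3))"
  proof -
    have "emeasure lborel (box (vector [l $ 2, l $ 3]) (vector [u $ 2, u $ 3] :: real ^ 2))
      = (\<Prod>b\<in>Basis. (vector [u $ 2, u $ 3] - vector [l $ 2, l $ 3] :: real ^ 2) \<bullet> b)"
      using le' by (intro emeasure_lborel_box) (auto simp: Basis_vec_def inner_axis)
    then show ?thesis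
      using le[of 1] unfolding prod_Basis_cart UNIV_2 by simp
  qed
  also have "\<dots> = (\<Prod>b\<in>Basis. (u - l) \<bullet> b)"
  proof -
    have "(\<Prod>b\<in>Basis. (u - l) \<bullet> b) = (u $ 1 - l $ 1) * ((u $ 2 - l $ 2) * (u $ 3 - l $ 3))"
      unfolding prod_Basis_cart UNIV_3 by simp
    then show ?thesis
      using le by (simp only:) (intro ennreal_mult[symmetric] mult_nonneg_nonneg; simp)
  qed
  finally show "emeasure (distr lborel borel ?f) (box l u) = (\<Prod>b\<in>Basis. (u - l) \<bullet> b)" .
qed simp

text \<open>This is the Fourier transform of the indicator of the ball of radius
  \<open>\<rho>\<close> in three dimensions, at a frequency of norm \<open>r\<close>. The value at
  \<open>r = 0\<close> is the volume of the ball.\<close>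

definition ball_cos :: "real \<Rightarrow> real \<Rightarrow> real" where
  "ball_cos r \<rho> = (if r = 0 then 4 / 3 * pi * \<rho> ^ 3
     else 4 * pi * (sin (\<rho> * r) - \<rho> * r * cos (\<rho> * r)) / r ^ 3)"

text \<open>Growing a ball adds the surface integral over its boundary sphere, that is, the area
  \<open>4 * pi * \<rho>\<^sup>2\<close> times the spherical mean. This connects the closed-form
  kernel with volume integrals.\<close>

lemma ball_cos_has_derivative:
  "(ball_cos (norm x) has_real_derivative 4 * pi * \<rho>\<^sup>2 * spherical_kernel \<rho> x) (at \<rho>)" if "\<rho> > 0"
proof (cases "x = 0")
  case True
  then show ?thesis
    unfolding ball_cos_def spherical_kernel_def
    by (auto intro!: derivative_eq_intros simp: power2_eq_square)
next
  case False
  then show ?thesis using that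
    unfolding ball_cos_def spherical_kernel_def
    by (auto intro!: derivative_eq_intros simp: field_simps power2_eq_square power3_eq_cube)
qed

text \<open>The weight \<open>pi * (\<rho>\<^sup>2 - t\<^sup>2)\<close> is the area of the disc cut
  from the ball at height \<open>t\<close>. Integrating by parts twice yields the antiderivative
  \<open>G\<close>.\<close>

lemma integral_paraboloid_cos:
  fixes \<rho> r :: real
  assumes "\<rho> \<ge> 0"
  shows "(LINT t:{-\<rho>..\<rho>}|lborel. pi * (\<rho>\<^sup>2 - t\<^sup>2) * cos (r * t)) = ball_cos r \<rho>"
proof -
  define G where "G t = (if r = 0 then pi * (\<rho>\<^sup>2 * t - t ^ 3 / 3)
     else pi * ((\<rho>\<^sup>2 - t\<^sup>2) * sin (r * t) / r - 2 * t * cos (r * t) / r\<^sup>2 + 2 * sin (r * t) / r ^ 3))" for t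
  have "(G has_real_derivative pi * (\<rho>\<^sup>2 - t\<^sup>2) * cos (r * t)) (at t)" for t
  proof (cases "r = 0")
    case True
    then show ?thesis unfolding G_def
      by (auto intro!: derivative_eq_intros simp: power2_eq_square algebra_simps)
  next
    case False
    then show ?thesis unfolding G_def
      by (auto intro!: derivative_eq_intros simp: divide_simps)
        (simp add: algebra_simps power2_eq_square power3_eq_cube eval_nat_numeral)
  qed
  then have "(LINT t:{-\<rho>..\<rho>}|lborel. pi * (\<rho>\<^sup>2 - t\<^sup>2) * cos (r * t)) = G \<rho> - G (-\<rho>)"
    unfolding set_lebesgue_integral_def using assms
    by (intro integral_FTC_Icc) (auto intro!: continuous_intros
       intro: has_field_derivative_at_within simp flip: has_real_derivative_iff_has_vector_derivative)
  also have "\<dots> = ball_cos r \<rho>"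
    unfolding G_def ball_cos_def
    by (auto simp: field_simps power2_eq_square power3_eq_cube)
  finally show ?thesis .
qed

text \<open>After a rotation the phase depends on the first coordinate only, so integrating over the
  perpendicular discs reduces the claim to a one-dimensional integral.\<close>

lemma integral_cball_cos:
  fixes x :: "real ^ 3"
  assumes \<rho>: "\<rho> \<ge> 0"
  shows "(LINT \<xi>:cball 0 \<rho>|lborel. cos (\<xi> \<bullet> x)) = ball_cos (norm x) \<rho>"
proof -
  define r where "r = norm x"
  have n: "norm (r *\<^sub>R axis 1 1 :: real ^ 3) = norm x"
    by (simp add: r_def)
  obtain T where T: "orthogonal_transformation T" and Tx: "T (r *\<^sub>R axis 1 1 :: real ^ 3) = x"
    by (rule orthogonal_transformation_exists[OF n])
  have Tm [measurable]: "T \<in> borel_measurable borel"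
    using T by (intro borel_measurable_continuous_onI linear_continuous_on
        linear_conv_bounded_linear[THEN iffD1] orthogonal_transformation_linear)
  let ?f = "\<lambda>(t, y :: real ^ 2). vector [t, y $ 1, y $ 2] :: real ^ 3"
  have fm [measurable]: "?f \<in> borel_measurable borel"
  proof -
    have "linear ?f"
      by (intro linearI) (auto simp: Finite_Cartesian_Product.vec_eq_iff forall_3)
    then show ?thesis
      by (intro borel_measurable_continuous_onI linear_continuous_on)
        (simp add: linear_conv_bounded_linear)
  qed
  have inner: "T \<xi> \<bullet> x = r * \<xi> $ 1" for \<xi>
  proof -
    have "T \<xi> \<bullet> x = T \<xi> \<bullet> T (r *\<^sub>R axis 1 1)"
      by (simp add: Tx)
    also have "\<dots> = \<xi> \<bullet> (r *\<^sub>R axis 1 1)"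
      using T by (simp add: orthogonal_transformation_def)
    finally show ?thesis by (simp add: inner_axis)
  qed
  have normT: "norm (T \<xi>) = norm \<xi>" for \<xi>
    using T by (rule orthogonal_transformation_norm)
  \<comment> \<open>The ball is the stack of discs of radius
    \<open>sqrt (\<rho>\<^sup>2 - t\<^sup>2)\<close> over \<open>t\<close> in
    \<open>{-\<rho>..\<rho>}\<close>.\<close>
  have norm_f: "norm (?f z) \<le> \<rho> \<longleftrightarrow> fst z \<in> {-\<rho>..\<rho>} \<and> norm (snd z) \<le> sqrt (\<rho>\<^sup>2 - (fst z)\<^sup>2)" for z
  proof -
    obtain t y where z: "z = (t, y)" by (cases z)
    have n: "(norm (?f z))\<^sup>2 = t\<^sup>2 + (norm y)\<^sup>2"
      unfolding z prod.case power2_norm_eq_inner inner_vec_def sum_3 sum_2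
      by (simp add: power2_eq_square)
    have "norm (?f z) \<le> \<rho> \<longleftrightarrow> (norm (?f z))\<^sup>2 \<le> \<rho>\<^sup>2"
      using \<rho> by (intro power_mono_iff[symmetric]) auto
    also have "\<dots> \<longleftrightarrow> t\<^sup>2 + (norm y)\<^sup>2 \<le> \<rho>\<^sup>2"
      unfolding n by simp
    also have "\<dots> \<longleftrightarrow> t\<^sup>2 \<le> \<rho>\<^sup>2 \<and> (norm y)\<^sup>2 \<le> \<rho>\<^sup>2 - t\<^sup>2"
      using zero_le_power2[of "norm y"] by linarith
    also have "(norm y)\<^sup>2 \<le> \<rho>\<^sup>2 - t\<^sup>2 \<longleftrightarrow> norm y \<le> sqrt (\<rho>\<^sup>2 - t\<^sup>2)"
      using real_le_rsqrt[of "norm y" "\<rho>\<^sup>2 - t\<^sup>2"] sqrt_ge_absD[of "norm y" "\<rho>\<^sup>2 - t\<^sup>2"] by auto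
    also have "t\<^sup>2 \<le> \<rho>\<^sup>2 \<longleftrightarrow> t \<in> {-\<rho>..\<rho>}"
      using \<rho> by (auto simp: abs_le_square_iff[symmetric])
    finally show ?thesis by (simp add: z)
  qed
  define G where "G \<xi> = indicator (cball 0 \<rho>) \<xi> * cos (r * \<xi> $ 1)" for \<xi> :: "real ^ 3"
  have Gm [measurable]: "G \<in> borel_measurable borel"
    unfolding G_def
    by (intro borel_measurable_times borel_measurable_indicator borel_measurable_continuous_onI
        continuous_intros) auto
  have "(LINT \<xi>:cball 0 \<rho>|lborel. cos (\<xi> \<bullet> x))
      = (LINT \<xi>|distr lborel borel T. indicator (cball 0 \<rho>) \<xi> * cos (\<xi> \<bullet> x))"
    by (simp add: lborel_distr_orthogonal[OF T] set_lebesgue_integral_def)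
  also have "\<dots> = (LINT \<xi>|lborel. G \<xi>)"
  proof (subst integral_distr)
    show "(\<lambda>\<xi>. indicator (cball 0 \<rho>) \<xi> * cos (\<xi> \<bullet> x)) \<in> borel_measurable borel"
      by (intro borel_measurable_times borel_measurable_indicator borel_measurable_continuous_onI
          continuous_intros) auto
    have "indicator (cball 0 \<rho>) (T \<xi>) * cos (T \<xi> \<bullet> x) = G \<xi>" for \<xi>
      by (simp add: G_def inner indicator_def normT)
    then show "(LINT \<xi>|lborel. indicator (cball 0 \<rho>) (T \<xi>) * cos (T \<xi> \<bullet> x)) = (LINT \<xi>|lborel. G \<xi>)"
      by simp
  qed (use Tm in simp)
  also have "\<dots> = (LINT \<xi>|distr lborel borel ?f. G \<xi>)"
    by (simp only: lborel_distr_prod_vec3)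
  also have "\<dots> = (LINT z|lborel. G (?f z))"
    using fm Gm by (intro integral_distr) simp_all
  also have "\<dots> = (LINT z|(lborel \<Otimes>\<^sub>M lborel). G (?f z))"
    by (simp only: lborel_prod)
  also have "\<dots> = (LINT t|lborel. LINT y|lborel. G (?f (t, y)))"
  proof (rule lborel_pair.integral_fst'[symmetric])
    have "integrable (distr lborel borel ?f) G"
      unfolding lborel_distr_prod_vec3
    proof (rule Bochner_Integration.integrable_bound)
      show "integrable lborel (indicat_real (cball (0 :: real ^ 3) \<rho>))"
        by (intro integrable_real_indicator emeasure_lborel_cball_finite) simp
    qed (auto simp: G_def indicator_def)
    then show "integrable (lborel \<Otimes>\<^sub>M lborel) (\<lambda>z. G (?f z))"
      unfolding lborel_prod using fm Gm by (subst (asm) integrable_distr_eq) simp_all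
  qed
  also have "\<dots> = (LINT t|lborel. indicator {-\<rho>..\<rho>} t * (pi * (\<rho>\<^sup>2 - t\<^sup>2) * cos (r * t)))"
  proof (rule Bochner_Integration.integral_cong[OF refl])
    fix t :: real
    have "(LINT y|lborel. G (?f (t, y))) = (LINT y|lborel. indicator {-\<rho>..\<rho>} t * cos (r * t)
        * indicator (cball 0 (sqrt (\<rho>\<^sup>2 - t\<^sup>2))) (y :: real ^ 2))"
    proof (rule Bochner_Integration.integral_cong[OF refl])
      fix y :: "real ^ 2"
      show "G (?f (t, y)) = indicator {-\<rho>..\<rho>} t * cos (r * t) * indicator (cball 0 (sqrt (\<rho>\<^sup>2 - t\<^sup>2))) y"
        using norm_f[of "(t, y)"] by (auto simp: G_def indicator_def)
    qed
    also have "\<dots> = indicator {-\<rho>..\<rho>} t * cos (r * t) * measure lborel (cball 0 (sqrt (\<rho>\<^sup>2 - t\<^sup>2)) :: (real ^ 2) set)"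
      by simp
    also have "\<dots> = indicator {-\<rho>..\<rho>} t * (pi * (\<rho>\<^sup>2 - t\<^sup>2) * cos (r * t))"
    proof (cases "t \<in> {-\<rho>..\<rho>}")
      case True
      then have "t\<^sup>2 \<le> \<rho>\<^sup>2"
        using \<rho> by (auto simp: abs_le_square_iff[symmetric])
      then show ?thesis
        by (simp add: content_cball unit_ball_vol_2)
    qed simp
    finally show "(LINT y|lborel. G (?f (t, y))) = indicator {-\<rho>..\<rho>} t * (pi * (\<rho>\<^sup>2 - t\<^sup>2) * cos (r * t))" .
  qed
  also have "\<dots> = ball_cos r \<rho>"
    using integral_paraboloid_cos[OF \<rho>, of r] by (simp add: set_lebesgue_integral_def)
  finally show ?thesis by (simp add: r_def)
qed

text \<open>For real coefficients the squared modulus expands into cosines of the phase differences,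
  each of which integrates to a value of \<open>ball_cos\<close>.\<close>

lemma integral_cball_trig_square:
  fixes x :: "'i \<Rightarrow> real ^ 3" and c :: "'i \<Rightarrow> real"
  assumes "\<rho> \<ge> 0"
  shows "set_integrable lborel (cball 0 \<rho>) (\<lambda>\<xi>. (norm (\<Sum>i\<in>I. c i * cis (\<xi> \<bullet> x i)))\<^sup>2)" (is ?int)
    and "(LINT \<xi>:cball 0 \<rho>|lborel. (norm (\<Sum>i\<in>I. c i * cis (\<xi> \<bullet> x i)))\<^sup>2)
      = (\<Sum>i\<in>I. \<Sum>j\<in>I. c i * c j * ball_cos (norm (x i - x j)) \<rho>)" (is ?eq)
proof -
  have sq: "(norm (\<Sum>i\<in>I. c i * cis (\<xi> \<bullet> x i)))\<^sup>2 = (\<Sum>i\<in>I. \<Sum>j\<in>I. c i * c j * cos (\<xi> \<bullet> (x i - x j)))" for \<xi>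
  proof -
    have "(norm (\<Sum>i\<in>I. c i * cis (\<xi> \<bullet> x i)))\<^sup>2
        = (\<Sum>i\<in>I. c i * cos (\<xi> \<bullet> x i))\<^sup>2 + (\<Sum>i\<in>I. c i * sin (\<xi> \<bullet> x i))\<^sup>2"
      by (simp add: cmod_power2)
    also have "\<dots> = (\<Sum>i\<in>I. \<Sum>j\<in>I. (c i * cos (\<xi> \<bullet> x i)) * (c j * cos (\<xi> \<bullet> x j))
        + (c i * sin (\<xi> \<bullet> x i)) * (c j * sin (\<xi> \<bullet> x j)))"
      by (simp only: power2_eq_square sum_product sum.distrib)
    also have "\<dots> = (\<Sum>i\<in>I. \<Sum>j\<in>I. c i * c j * cos (\<xi> \<bullet> (x i - x j)))"
      by (intro sum.cong refl) (simp add: cos_diff inner_diff_right algebra_simps)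
    finally show ?thesis .
  qed
  have int: "integrable lborel (\<lambda>\<xi>. indicator (cball 0 \<rho>) \<xi> *\<^sub>R (c i * c j * cos (\<xi> \<bullet> (x i - x j))))" for i j
    by (intro borel_integrable_compact continuous_intros) auto
  show ?int
    unfolding sq set_integrable_def scaleR_sum_right
    by (intro Bochner_Integration.integrable_sum int)
  have "(LINT \<xi>:cball 0 \<rho>|lborel. (norm (\<Sum>i\<in>I. c i * cis (\<xi> \<bullet> x i)))\<^sup>2)
      = (\<Sum>i\<in>I. \<Sum>j\<in>I. LINT \<xi>|lborel. indicator (cball 0 \<rho>) \<xi> *\<^sub>R (c i * c j * cos (\<xi> \<bullet> (x i - x j))))"
    unfolding sq set_lebesgue_integral_def scaleR_sum_right
    by (subst Bochner_Integration.integral_sum, intro Bochner_Integration.integrable_sum int,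
        intro sum.cong refl Bochner_Integration.integral_sum int)
  also have "\<dots> = (\<Sum>i\<in>I. \<Sum>j\<in>I. c i * c j * ball_cos (norm (x i - x j)) \<rho>)"
  proof (intro sum.cong refl)
    fix i j
    have "(LINT \<xi>|lborel. indicator (cball 0 \<rho>) \<xi> *\<^sub>R (c i * c j * cos (\<xi> \<bullet> (x i - x j))))
        = (LINT \<xi>:cball 0 \<rho>|lborel. c i * c j * cos (\<xi> \<bullet> (x i - x j)))"
      by (simp only: set_lebesgue_integral_def)
    also have "\<dots> = c i * c j * (LINT \<xi>:cball 0 \<rho>|lborel. cos (\<xi> \<bullet> (x i - x j)))"
      by (rule set_integral_mult_right)
    finally show "(LINT \<xi>|lborel. indicator (cball 0 \<rho>) \<xi> *\<^sub>R (c i * c j * cos (\<xi> \<bullet> (x i - x j))))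
        = c i * c j * ball_cos (norm (x i - x j)) \<rho>"
      using assms by (simp only: integral_cball_cos)
  qed
  finally show ?eq .
qed

section \<open>From balls to spheres\<close>

text \<open>
  Differentiating the integral over \<open>cball 0 \<rho>\<close> with respect to \<open>\<rho>\<close> at \<open>\<kappa>\<close> replaces a surface
  integral over the sphere of radius \<open>\<kappa>\<close>.
\<close>

lemma spherical_form_bounds:
  fixes x :: "'i \<Rightarrow> real ^ 3" and c :: "'i \<Rightarrow> real"
  assumes \<kappa>: "\<kappa> > 0"
  shows spherical_form_nonneg: "0 \<le> (\<Sum>i\<in>I. \<Sum>j\<in>I. c i * c j * spherical_kernel \<kappa> (x i - x j))"
    and spherical_form_le: "\<lbrakk>\<epsilon> > 0; \<And>\<xi>. \<kappa> \<le> norm \<xi> \<Longrightarrow> norm \<xi> \<le> \<kappa> + \<epsilon> \<Longrightarrow> (norm (\<Sum>i\<in>I. c i * cis (\<xi> \<bullet> x i)))\<^sup>2 \<le> B\<rbrakk>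
      \<Longrightarrow> (\<Sum>i\<in>I. \<Sum>j\<in>I. c i * c j * spherical_kernel \<kappa> (x i - x j)) \<le> B"
proof -
  define P where "P \<xi> = (norm (\<Sum>i\<in>I. c i * cis (\<xi> \<bullet> x i)))\<^sup>2" for \<xi>
  define \<Phi> where "\<Phi> \<rho> = (\<Sum>i\<in>I. \<Sum>j\<in>I. c i * c j * ball_cos (norm (x i - x j)) \<rho>)" for \<rho>
  define Q where "Q = (\<Sum>i\<in>I. \<Sum>j\<in>I. c i * c j * spherical_kernel \<kappa> (x i - x j))"
  have der: "(\<Phi> has_real_derivative 4 * pi * \<kappa>\<^sup>2 * Q) (at \<kappa>)"
    unfolding \<Phi>_def Q_def
    by (auto intro!: derivative_eq_intros ball_cos_has_derivative[OF \<kappa>] simp: sum_distrib_left mult_ac)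
  have int: "set_integrable lborel (cball 0 \<rho>) P"
    and \<Phi>: "\<Phi> \<rho> = (LINT \<xi>:cball 0 \<rho>|lborel. P \<xi>)" if "\<rho> \<ge> 0" for \<rho>
    using integral_cball_trig_square[OF that, of c x I] by (simp_all add: P_def[abs_def] \<Phi>_def)
  \<comment> \<open>A negative derivative would make \<open>f\<close> strictly decrease just to the
    right of \<open>\<kappa>\<close>, so one-sided comparison suffices. Both bounds are instances of
    this.\<close>
  have slope: "0 \<le> D" if "(f has_real_derivative D) (at \<kappa>)" "\<epsilon> > 0"
      "\<And>\<rho>. \<kappa> < \<rho> \<Longrightarrow> \<rho> < \<kappa> + \<epsilon> \<Longrightarrow> f \<kappa> \<le> f \<rho>" for f D \<epsilon>
  proof (rule ccontr)
    assume "\<not> 0 \<le> D"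
    with DERIV_neg_dec_right[OF that(1)] obtain d where "d > 0" "\<And>h. 0 < h \<Longrightarrow> h < d \<Longrightarrow> f (\<kappa> + h) < f \<kappa>"
      by auto
    moreover have "0 < min d \<epsilon> / 2" "min d \<epsilon> / 2 < d" "min d \<epsilon> / 2 < \<epsilon>"
      using that(2) \<open>d > 0\<close> by (auto simp: min_def)
    ultimately show False
      using that(3)[of "\<kappa> + min d \<epsilon> / 2"] by fastforce
  qed
  \<comment> \<open>Increments of \<open>\<Phi>\<close> are integrals of \<open>P\<close> over
    spherical shells, so pointwise bounds on \<open>P\<close> near the sphere become bounds on the
    derivative of \<open>\<Phi>\<close>.\<close>
  have diff: "\<Phi> \<rho> - \<Phi> \<kappa> = (LINT \<xi>:cball 0 \<rho> - cball 0 \<kappa>|lborel. P \<xi>)"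
    and int_diff: "set_integrable lborel (cball 0 \<rho> - cball 0 \<kappa>) P" if "\<kappa> < \<rho>" for \<rho>
  proof -
    show int': "set_integrable lborel (cball 0 \<rho> - cball 0 \<kappa>) P"
      by (rule set_integrable_subset[OF int[of \<rho>]]) (use that \<kappa> in auto)
    have "cball 0 \<rho> = cball 0 \<kappa> \<union> (cball 0 \<rho> - cball (0 :: real ^ 3) \<kappa>)"
      using that by auto
    then have "\<Phi> \<rho> = (LINT \<xi>:cball 0 \<kappa> \<union> (cball 0 \<rho> - cball 0 \<kappa>)|lborel. P \<xi>)"
      using \<Phi>[of \<rho>] that \<kappa> by simp
    also have "\<dots> = \<Phi> \<kappa> + (LINT \<xi>:cball 0 \<rho> - cball 0 \<kappa>|lborel. P \<xi>)"
      using \<kappa> by (subst set_integral_Un) (auto simp: \<Phi> int int')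
    finally show "\<Phi> \<rho> - \<Phi> \<kappa> = (LINT \<xi>:cball 0 \<rho> - cball 0 \<kappa>|lborel. P \<xi>)" by simp
  qed
  have K: "4 * pi * \<kappa>\<^sup>2 > 0"
    using \<kappa> by simp
  have "0 \<le> 4 * pi * \<kappa>\<^sup>2 * Q"
  proof (rule slope[OF der, of 1])
    fix \<rho> assume \<rho>: "\<kappa> < \<rho>"
    have "0 \<le> (LINT \<xi>:cball 0 \<rho> - cball 0 \<kappa>|lborel. P \<xi>)"
      unfolding set_lebesgue_integral_def by (intro Bochner_Integration.integral_nonneg) (auto simp: P_def)
    then show "\<Phi> \<kappa> \<le> \<Phi> \<rho>" using diff[OF \<rho>] by simp
  qed simp
  then show "0 \<le> Q"
    using mult_le_cancel_left_pos[OF K, of 0 Q] by simp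
  assume "\<epsilon> > 0" and B: "\<And>\<xi>. \<kappa> \<le> norm \<xi> \<Longrightarrow> norm \<xi> \<le> \<kappa> + \<epsilon> \<Longrightarrow> (norm (\<Sum>i\<in>I. c i * cis (\<xi> \<bullet> x i)))\<^sup>2 \<le> B"
  \<comment> \<open>\<open>V\<close> is the volume of the ball. If \<open>P\<close> is at most
    \<open>B\<close> on the shell, then \<open>B * V - \<Phi>\<close> does not fall below its value
    at \<open>\<kappa>\<close>, and \<open>slope\<close> applies to it.\<close>
  define V where "V \<rho> = 4 / 3 * pi * \<rho> ^ 3" for \<rho> :: real
  have "0 \<le> B * (4 * pi * \<kappa>\<^sup>2) - 4 * pi * \<kappa>\<^sup>2 * Q"
  proof (rule slope[OF _ \<open>\<epsilon> > 0\<close>])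
    show "((\<lambda>\<rho>. B * V \<rho> - \<Phi> \<rho>) has_real_derivative B * (4 * pi * \<kappa>\<^sup>2) - 4 * pi * \<kappa>\<^sup>2 * Q) (at \<kappa>)"
      unfolding V_def by (auto intro!: derivative_eq_intros der)
    fix \<rho> assume \<rho>: "\<kappa> < \<rho>" "\<rho> < \<kappa> + \<epsilon>"
    have "\<Phi> \<rho> - \<Phi> \<kappa> \<le> (LINT \<xi>:cball 0 \<rho> - cball (0 :: real ^ 3) \<kappa>|lborel. B)"
      unfolding diff[OF \<rho>(1)]
    proof (rule set_integral_mono)
      show "set_integrable lborel (cball 0 \<rho> - cball (0 :: real ^ 3) \<kappa>) (\<lambda>_. B)"
        by (rule set_integrable_subset[of _ "cball 0 \<rho>"])
          (auto intro!: borel_integrable_compact[unfolded set_integrable_def[symmetric]])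
      show "P \<xi> \<le> B" if "\<xi> \<in> cball 0 \<rho> - cball 0 \<kappa>" for \<xi>
        using that \<rho> B[of \<xi>] by (simp add: P_def)
    qed (rule int_diff[OF \<rho>(1)])
    also have "\<dots> = B * measure lborel (cball 0 \<rho> - cball (0 :: real ^ 3) \<kappa>)"
      by (simp add: set_lebesgue_integral_def)
    also have "measure lborel (cball 0 \<rho> - cball (0 :: real ^ 3) \<kappa>) = V \<rho> - V \<kappa>"
    proof (subst measure_Diff)
      show "emeasure lborel (cball (0 :: real ^ 3) \<rho>) \<noteq> \<infinity>"
        using emeasure_lborel_cball_finite[of "0 :: real ^ 3" \<rho>] by simp
    qed (use \<rho> \<kappa> in \<open>auto simp: content_cball unit_ball_vol_3 V_def\<close>)
    finally show "B * V \<kappa> - \<Phi> \<kappa> \<le> B * V \<rho> - \<Phi> \<rho>" by (simp add: algebra_simps)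
  qed
  then have "4 * pi * \<kappa>\<^sup>2 * Q \<le> 4 * pi * \<kappa>\<^sup>2 * B" by (simp add: mult_ac)
  then show "Q \<le> B"
    using mult_le_cancel_left_pos[OF K] by blast
qed

subsection \<open>The smallest eigenvalue of a symmetric matrix\<close>

text \<open>The quadratic form attains its minimum on the compact unit sphere, and the vanishing of
  its first variation there is the eigenvalue equation.\<close>

lemma rayleigh_minimizer:
  fixes a :: "nat \<Rightarrow> nat \<Rightarrow> real"
  assumes "n > 0" and sym: "\<And>i j. a i j = a j i"
  obtains f l where "(\<Sum>i<n. (f i)\<^sup>2) = 1"
    and "\<And>v. l * (\<Sum>i<n. (v i)\<^sup>2) \<le> (\<Sum>i<n. \<Sum>j<n. v i * v j * a i j)"
    and "\<And>i. i < n \<Longrightarrow> (\<Sum>j<n. a i j * f j) = l * f i"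
proof -
  define N :: "(nat \<Rightarrow> real) \<Rightarrow> real" where "N v = (\<Sum>i<n. (v i)\<^sup>2)" for v
  define q :: "(nat \<Rightarrow> real) \<Rightarrow> real" where "q v = (\<Sum>i<n. \<Sum>j<n. v i * v j * a i j)" for v
  \<comment> \<open>Vectors are functions on all naturals. Pinning the coordinates from
    \<open>n\<close> on to 0 makes this product of compact sets compact by Tychonoff, and the unit
    sphere becomes a closed subset of it.\<close>
  define box :: "(nat \<Rightarrow> real) set" where
    "box = PiE UNIV (\<lambda>i. if i < n then {-1..1} else {0})"
  define S where "S = box \<inter> {v. N v = 1}"
  have "compact box"
    unfolding box_def compactin_euclidean_iff[symmetric] euclidean_product_topology[symmetric]
    by (subst compactin_PiE) auto
  moreover have contN: "continuous_on UNIV N" and contq: "continuous_on UNIV q"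
    unfolding N_def q_def by (intro continuous_intros continuous_on_product_coordinates)+
  then have "closed {v. N v = 1}"
    by (intro closed_Collect_eq continuous_on_const)
  ultimately have "compact S"
    unfolding S_def by (rule compact_Int_closed)
  moreover have "(\<lambda>i. if i = 0 then 1 else 0) \<in> S"
  proof -
    have "(\<Sum>i<n. (if i = 0 then 1 else 0 :: real)\<^sup>2) = (\<Sum>i<n. if i = 0 then 1 else 0)"
      by (intro sum.cong) auto
    then show ?thesis
      using \<open>n > 0\<close> by (auto simp: S_def box_def N_def PiE_def)
  qed
  ultimately obtain f where f: "f \<in> S" and min: "\<And>v. v \<in> S \<Longrightarrow> q f \<le> q v"
    using continuous_attains_inf[of S q] continuous_on_subset[OF contq] by blast
  define l where "l = q f"
  have Nf: "N f = 1"
    using f by (simp add: S_def)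
  have scale: "N (\<lambda>i. c * v i) = c\<^sup>2 * N v" "q (\<lambda>i. c * v i) = c\<^sup>2 * q v" for c v
    by (simp_all add: N_def q_def sum_distrib_left power2_eq_square mult_ac)
  have le: "l * N v \<le> q v" for v
  proof (cases "N v = 0")
    case True
    then have "v i = 0" if "i < n" for i
      using that by (auto simp: N_def sum_nonneg_eq_0_iff)
    then have "q v = 0"
      by (simp add: q_def)
    with True show ?thesis by simp
  next
    case False
    then have pos: "N v > 0"
      using sum_nonneg[of "{..<n}" "\<lambda>i. (v i)\<^sup>2"] by (simp add: N_def)
    define w where "w i = (if i < n then v i / sqrt (N v) else 0)" for i
    have "N w = N (\<lambda>i. 1 / sqrt (N v) * v i)" "q w = q (\<lambda>i. 1 / sqrt (N v) * v i)"
      by (auto simp: N_def q_def w_def intro!: sum.cong)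
    then have Nw: "N w = 1" and qw: "q w = q v / N v"
      using pos by (simp_all only: scale) (simp_all add: power_divide)
    have "\<bar>w i\<bar> \<le> 1" if "i < n" for i
    proof -
      have "(w i)\<^sup>2 \<le> N w"
        unfolding N_def using that by (intro member_le_sum) auto
      then show ?thesis
        by (simp add: Nw abs_square_le_1)
    qed
    then have "w i \<in> (if i < n then {-1..1} else {0})" for i
      by (cases "i < n") (auto simp: abs_le_iff minus_le_iff, simp add: w_def)
    then have "w \<in> S"
      using Nw by (auto simp: S_def box_def)
    then show ?thesis
      using min[of w] pos by (simp add: qw l_def pos_le_divide_eq)
  qed
  have eig: "(\<Sum>j<n. a k j * f j) = l * f k" if k: "k < n" for k
  proof -
    \<comment> \<open>Perturb the minimizer along the coordinate \<open>k\<close>. In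
      \<open>le\<close> at \<open>f + t * e\<close> the constant terms cancel, so the linear
      coefficient \<open>2 * d\<close> has to vanish.\<close>
    define e where "e = (\<lambda>i. if i = k then 1 else 0 :: real)"
    define d where "d = (\<Sum>j<n. a k j * f j) - l * f k"
    have e1: "(\<Sum>i<n. g i * e i) = g k" for g
      using k by (simp add: e_def sum.delta if_distrib cong: if_cong)
    have N: "N (\<lambda>i. f i + t * e i) = 1 + 2 * t * f k + t\<^sup>2" for t
    proof -
      have "N (\<lambda>i. f i + t * e i) = (\<Sum>i<n. (f i)\<^sup>2 + (2 * t * f i) * e i + (t\<^sup>2 * e i) * e i)"
        by (simp add: N_def power2_eq_square algebra_simps)
      also have "\<dots> = 1 + 2 * t * f k + t\<^sup>2 * e k"
        using Nf by (simp only: sum.distrib e1 N_def)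
      finally show ?thesis by (simp add: e_def)
    qed
    have q: "q (\<lambda>i. f i + t * e i) = l + 2 * t * (\<Sum>j<n. a k j * f j) + t\<^sup>2 * a k k" for t
    proof -
      have "(\<Sum>j<n. (f i + t * e i) * (f j + t * e j) * a i j)
        = (\<Sum>j<n. f i * f j * a i j) + t * (\<Sum>j<n. f j * a i j) * e i + t * f i * a i k + t\<^sup>2 * a i k * e i" for i
      proof -
        have "(\<Sum>j<n. (f i + t * e i) * (f j + t * e j) * a i j)
          = (\<Sum>j<n. f i * f j * a i j + t * e i * (f j * a i j) + (t * f i * a i j) * e j + (t\<^sup>2 * a i j * e i) * e j)"
          by (simp add: power2_eq_square algebra_simps)
        also have "\<dots> = (\<Sum>j<n. f i * f j * a i j) + t * e i * (\<Sum>j<n. f j * a i j) + t * f i * a i k + t\<^sup>2 * a i k * e i"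
          by (simp only: sum.distrib e1 sum_distrib_left)
        finally show ?thesis by (simp add: algebra_simps)
      qed
      then have "q (\<lambda>i. f i + t * e i) = (\<Sum>i<n. (\<Sum>j<n. f i * f j * a i j)
          + t * (\<Sum>j<n. f j * a i j) * e i + t * f i * a i k + t\<^sup>2 * a i k * e i)"
        by (simp add: q_def)
      also have "\<dots> = l + t * (\<Sum>j<n. f j * a k j) + t * (\<Sum>i<n. f i * a i k) + t\<^sup>2 * a k k"
        by (simp only: sum.distrib e1) (simp add: l_def q_def sum_distrib_left mult.assoc)
      also have "\<dots> = l + 2 * t * (\<Sum>j<n. a k j * f j) + t\<^sup>2 * a k k"
      proof -
        have "(\<Sum>j<n. f j * a k j) = (\<Sum>j<n. a k j * f j)"
          by (intro sum.cong refl mult.commute)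
        moreover have "(\<Sum>i<n. f i * a i k) = (\<Sum>j<n. a k j * f j)"
          by (intro sum.cong refl, subst sym, rule mult.commute)
        ultimately show ?thesis by simp
      qed
      finally show ?thesis .
    qed
    have pos: "0 \<le> 2 * t * d + t\<^sup>2 * (a k k - l)" for t
      using le[of "\<lambda>i. f i + t * e i"] unfolding N q by (simp add: d_def algebra_simps)
    \<comment> \<open>With \<open>b\<close> above the quadratic coefficient, the choice
      \<open>t = - d / b\<close> makes the linear term \<open>- 2 * d\<^sup>2 / b\<close> and the
      quadratic term at most \<open>d\<^sup>2 / b\<close>, which forces
      \<open>d = 0\<close>.\<close>
    define b where "b = \<bar>a k k - l\<bar> + 1"
    have b: "b > 0" by (simp add: b_def)
    have "0 \<le> 2 * (- d / b) * d + (- d / b)\<^sup>2 * (a k k - l)"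
      by (rule pos)
    also have "\<dots> \<le> 2 * (- d / b) * d + (- d / b)\<^sup>2 * b"
      by (intro add_left_mono mult_left_mono) (auto simp: b_def)
    also have "\<dots> = - (d\<^sup>2 / b)"
      using b by (simp add: power2_eq_square field_simps)
    finally have "d\<^sup>2 / b \<le> 0" by simp
    then have "d = 0"
      using b by (simp add: divide_le_0_iff)
    then show ?thesis by (simp add: d_def)
  qed
  show thesis
    by (rule that[of f l, OF Nf[unfolded N_def] le[unfolded N_def q_def] eig])
qed

text \<open>The minimum of the Rayleigh quotient is an eigenvalue, so the finite spectrum is
  nonempty and its \<open>Min\<close> lies below every Rayleigh quotient. For the second claim, the
  form is evaluated at an eigenvector of \<open>lambda_min A\<close>.\<close>

lemma lambda_min_symmetric:
  fixes A :: "real mat"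
  assumes A: "A \<in> carrier_mat n n" and "n > 0"
    and sym: "\<And>i j. i < n \<Longrightarrow> j < n \<Longrightarrow> A $$ (i, j) = A $$ (j, i)"
  shows lambda_min_le_rayleigh:
      "lambda_min A * (\<Sum>i<n. (v i)\<^sup>2) \<le> (\<Sum>i<n. \<Sum>j<n. v i * v j * A $$ (i, j))"
    and lambda_min_nonneg:
      "(\<And>v. (\<Sum>i<n. \<Sum>j<n. v i * v j * A $$ (i, j)) \<ge> 0) \<Longrightarrow> lambda_min A \<ge> 0"
proof -
  \<comment> \<open>Entries outside the matrix are set to 0 because
    \<open>rayleigh_minimizer\<close> asks for symmetry at all pairs of naturals.\<close>
  define a where "a i j = (if i < n \<and> j < n then A $$ (i, j) else 0)" for i j
  have Aa: "(\<Sum>i<n. \<Sum>j<n. v i * v j * A $$ (i, j)) = (\<Sum>i<n. \<Sum>j<n. v i * v j * a i j)" for v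
    by (intro sum.cong) (auto simp: a_def)
  obtain f l where f: "(\<Sum>i<n. (f i)\<^sup>2) = 1"
    and le: "\<And>v. l * (\<Sum>i<n. (v i)\<^sup>2) \<le> (\<Sum>i<n. \<Sum>j<n. v i * v j * a i j)"
    and eig: "\<And>i. i < n \<Longrightarrow> (\<Sum>j<n. a i j * f j) = l * f i"
    by (rule rayleigh_minimizer[of n a]) (use \<open>n > 0\<close> sym in \<open>auto simp: a_def\<close>)
  have "eigenvector A (vec n f) l"
    unfolding eigenvector_def
  proof (intro conjI)
    show "vec n f \<noteq> 0\<^sub>v (dim_row A)"
    proof
      assume "vec n f = 0\<^sub>v (dim_row A)"
      then have "f i = 0" if "i < n" for i
        using that A by (metis carrier_matD(1) index_vec index_zero_vec(1))
      with f show False by simp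
    qed
    show "A *\<^sub>v vec n f = l \<cdot>\<^sub>v vec n f"
    proof (rule eq_vecI)
      fix i assume "i < dim_vec (l \<cdot>\<^sub>v vec n f)"
      then have i: "i < n" by simp
      have "vec_index (A *\<^sub>v vec n f) i = (\<Sum>j<n. a i j * f j)"
        using A i by (auto simp: scalar_prod_def a_def lessThan_atLeast0 intro!: sum.cong)
      then show "vec_index (A *\<^sub>v vec n f) i = vec_index (l \<cdot>\<^sub>v vec n f) i"
        using i eig by simp
    qed (use A in auto)
  qed (use A in auto)
  then have l: "l \<in> spectrum A"
    by (auto simp: spectrum_def eigenvalue_def)
  have fin: "finite (spectrum A)"
    using A by (rule card_finite_spectrum)
  have "lambda_min A * (\<Sum>i<n. (v i)\<^sup>2) \<le> l * (\<Sum>i<n. (v i)\<^sup>2)"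
    unfolding lambda_min_def using l fin by (intro mult_right_mono sum_nonneg) auto
  with le[of v] show "lambda_min A * (\<Sum>i<n. (v i)\<^sup>2) \<le> (\<Sum>i<n. \<Sum>j<n. v i * v j * A $$ (i, j))"
    unfolding Aa by linarith
  assume nonneg: "\<And>v. (\<Sum>i<n. \<Sum>j<n. v i * v j * A $$ (i, j)) \<ge> 0"
  have "lambda_min A \<in> spectrum A"
    unfolding lambda_min_def using l fin by (intro Min_in) auto
  then obtain w where w: "w \<in> carrier_vec n" "w \<noteq> 0\<^sub>v n" "A *\<^sub>v w = lambda_min A \<cdot>\<^sub>v w"
    using A by (auto simp: spectrum_def eigenvalue_def eigenvector_def)
  define u where "u = vec_index w"
  have Au: "(\<Sum>j<n. A $$ (i, j) * u j) = lambda_min A * u i" if "i < n" for i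
  proof -
    have "(\<Sum>j<n. A $$ (i, j) * u j) = vec_index (A *\<^sub>v w) i"
      using A w(1) that by (auto simp: scalar_prod_def u_def lessThan_atLeast0 intro!: sum.cong)
    then show ?thesis
      using w that by (simp add: u_def)
  qed
  have "(\<Sum>i<n. \<Sum>j<n. u i * u j * A $$ (i, j)) = (\<Sum>i<n. u i * (\<Sum>j<n. A $$ (i, j) * u j))"
    by (simp add: sum_distrib_left mult_ac)
  also have "\<dots> = (\<Sum>i<n. u i * (lambda_min A * u i))"
    by (intro sum.cong) (auto simp: Au)
  also have "\<dots> = lambda_min A * (\<Sum>i<n. (u i)\<^sup>2)"
    by (simp add: sum_distrib_left power2_eq_square mult_ac)
  finally have "0 \<le> lambda_min A * (\<Sum>i<n. (u i)\<^sup>2)"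
    using nonneg[of u] by simp
  moreover have "(\<Sum>i<n. (u i)\<^sup>2) > 0"
  proof -
    obtain i where i: "i < n" "u i \<noteq> 0"
      using w by (metis carrier_vecD eq_vecI index_zero_vec(1) index_zero_vec(2) u_def)
    then have "0 < (u i)\<^sup>2" by simp
    also have "\<dots> \<le> (\<Sum>i<n. (u i)\<^sup>2)"
      using i by (intro member_le_sum) auto
    finally show ?thesis .
  qed
  ultimately show "lambda_min A \<ge> 0"
    by (simp add: zero_le_mult_iff)
qed

subsection \<open>Trigonometric polynomials and the integer lattice\<close>

text \<open>Repeated convolution of the geometric sum with itself. The coefficients are real, as the
  test vector for the Gram matrix must be.\<close>

lemma geometric_power_coeffs:
  obtains b :: "nat \<Rightarrow> real" where
    "\<And>z :: complex. (\<Sum>a\<le>L * q. b a * z ^ a) = (\<Sum>a\<le>q. z ^ a) ^ L"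
proof -
  have "\<exists>b :: nat \<Rightarrow> real. \<forall>z :: complex. (\<Sum>a\<le>L * q. b a * z ^ a) = (\<Sum>a\<le>q. z ^ a) ^ L"
  proof (induction L)
    case 0
    show ?case by (intro exI[of _ "\<lambda>_. 1"]) simp
  next
    case (Suc L)
    then obtain b :: "nat \<Rightarrow> real" where b: "\<And>z :: complex. (\<Sum>a\<le>L * q. b a * z ^ a) = (\<Sum>a\<le>q. z ^ a) ^ L"
      by blast
    let ?S = "{..L * q} \<times> {..q}"
    define b' where "b' n = (\<Sum>s\<in>{s \<in> ?S. fst s + snd s = n}. b (fst s))" for n
    have "(\<Sum>n\<le>Suc L * q. b' n * z ^ n) = (\<Sum>a\<le>q. z ^ a) ^ Suc L" for z :: complex
    proof -
      have "(\<Sum>a\<le>q. z ^ a) ^ Suc L = (\<Sum>a\<le>L * q. b a * z ^ a) * (\<Sum>a\<le>q. z ^ a)"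
        unfolding b by (simp add: mult.commute)
      also have "\<dots> = (\<Sum>s\<in>?S. b (fst s) * z ^ (fst s + snd s))"
        unfolding sum_product sum.cartesian_product
        by (intro sum.cong) (auto simp: power_add)
      also have "\<dots> = (\<Sum>n\<in>{..Suc L * q}. \<Sum>s\<in>{s \<in> ?S. fst s + snd s = n}. b (fst s) * z ^ (fst s + snd s))"
        by (rule sum.group[symmetric]) auto
      also have "\<dots> = (\<Sum>n\<le>Suc L * q. b' n * z ^ n)"
        by (intro sum.cong refl) (simp add: b'_def sum_distrib_right)
      finally show ?thesis by simp
    qed
    then show ?case by blast
  qed
  with that show thesis by blast
qed

text \<open>Telescoping against \<open>1 - cis \<theta>\<close>, whose modulus is
  \<open>2 * \<bar>sin (\<theta> / 2)\<bar>\<close>, leaves a difference of two unit numbers. The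
  product form also covers a vanishing sine.\<close>

lemma norm_geometric_cis_le:
  "norm (\<Sum>a\<le>q. cis \<theta> ^ a) * \<bar>sin (\<theta> / 2)\<bar> \<le> 1"
proof -
  have "(norm (1 - cis \<theta>))\<^sup>2 = (2 * \<bar>sin (\<theta> / 2)\<bar>)\<^sup>2"
  proof -
    have "(norm (1 - cis \<theta>))\<^sup>2 = (1 - cos \<theta>)\<^sup>2 + (sin \<theta>)\<^sup>2"
      by (simp add: cmod_power2)
    also have "\<dots> = 2 * (1 - cos (2 * (\<theta> / 2)))"
      using sin_cos_squared_add[of \<theta>] by (simp add: power2_eq_square algebra_simps)
    also have "\<dots> = 4 * (sin (\<theta> / 2))\<^sup>2"
      by (subst cos_double_sin) simp
    finally show ?thesis by (simp add: power_mult_distrib)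
  qed
  then have n: "norm (1 - cis \<theta>) = 2 * \<bar>sin (\<theta> / 2)\<bar>"
    by (rule power2_eq_imp_eq) simp_all
  have "2 * (norm (\<Sum>a\<le>q. cis \<theta> ^ a) * \<bar>sin (\<theta> / 2)\<bar>) = norm ((1 - cis \<theta>) * (\<Sum>a\<le>q. cis \<theta> ^ a))"
    by (simp add: norm_mult n)
  also have "(1 - cis \<theta>) * (\<Sum>a\<le>q. cis \<theta> ^ a) = 1 - cis \<theta> ^ Suc q"
    by (rule sum_gp_basic)
  also have "norm (1 - cis \<theta> ^ Suc q) \<le> 1 + 1"
    by (rule order.trans[OF norm_triangle_ineq4]) (simp add: norm_power norm_mult)
  finally show ?thesis by simp
qed

text \<open>A weak form of Jordan's inequality. Up to \<open>pi / 3\<close> the derivative of the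
  sine is at least 1/2; beyond that point the sine itself is at least 1/2.\<close>

lemma sin_ge_over_pi:
  assumes "0 \<le> y" "y \<le> pi / 2"
  shows "y / pi \<le> sin y"
proof (cases "y \<le> pi / 3")
  case True
  show ?thesis
  proof (cases "y = 0")
    case False
    with assms have "0 < y" by simp
    then obtain t where t: "0 < t" "t < y" "sin y - sin 0 = (y - 0) * cos t"
      using MVT2[of 0 y sin cos] by (auto intro: DERIV_sin)
    have "cos (pi / 3) \<le> cos t"
      using t True by (intro cos_monotone_0_pi_le) auto
    then have "y * (1 / 2) \<le> sin y"
      using t \<open>0 < y\<close> by (simp add: cos_60)
    moreover have "y / pi \<le> y / 2"
      using pi_ge_two \<open>0 < y\<close> by (intro divide_left_mono) auto
    ultimately show ?thesis by linarith
  qed simp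
next
  case False
  have "sin (pi / 6) \<le> sin y"
    using False assms by (intro sin_monotone_2pi_le) auto
  then have "1 / 2 \<le> sin y" by (simp add: sin_30)
  moreover have "y / pi \<le> 1 / 2"
    using assms by (simp add: field_simps)
  ultimately show ?thesis by linarith
qed

text \<open>The function \<open>\<bar>sin (pi * u)\<bar>\<close> has period 1 and is even, so only
  the distance to the nearest integer matters, and on it the linear lower bound of the sine
  applies.\<close>

lemma abs_sin_ge_dist_int:
  fixes d u :: real
  assumes "\<And>n :: int. d \<le> \<bar>u - n\<bar>"
  shows "d \<le> \<bar>sin (pi * u)\<bar>"
proof -
  define w where "w = u - round u"
  define e where "e = \<bar>w\<bar>"
  have e: "d \<le> e" "0 \<le> e" "e \<le> 1 / 2"
    using assms[of "round u"] of_int_round_abs_le[of u] by (auto simp: e_def w_def abs_minus_commute)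
  have sin0: "sin (pi * round u) = 0"
    by (auto simp: sin_zero_iff_int2)
  have "\<bar>sin (pi * u)\<bar> = \<bar>sin (pi * w + pi * round u)\<bar>"
    by (simp add: w_def algebra_simps)
  also have "\<dots> = \<bar>sin (pi * w)\<bar> * \<bar>cos (pi * round u)\<bar>"
    by (simp add: sin_add sin0 abs_mult)
  also have "\<bar>cos (pi * round u)\<bar> = 1"
    using sin0 by (rule sin_zero_abs_cos_one)
  also have "\<bar>sin (pi * w)\<bar> = \<bar>sin (pi * e)\<bar>"
    by (cases "w \<ge> 0") (simp_all add: e_def)
  finally have "\<bar>sin (pi * u)\<bar> = \<bar>sin (pi * e)\<bar>" by simp
  moreover have "pi * e / pi \<le> sin (pi * e)"
    using e by (intro sin_ge_over_pi) auto
  ultimately show ?thesis using e by simp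
qed

text \<open>If every coordinate were within \<open>d\<close> of an integer, each square would be
  within 1/24 of an integer square, because \<open>d * (2 * U + 1) < 1 / 24\<close>; this is the
  origin of 48. Then the squared norm would lie strictly within 1/8 of an integer, which the window
  from \<open>N + 1/4\<close> to \<open>N + 7/8\<close> excludes.\<close>

lemma coordinate_far_from_int:
  fixes u :: "real ^ 3" and N :: int
  assumes lo: "N + 1/4 \<le> (norm u)\<^sup>2" and hi: "(norm u)\<^sup>2 \<le> N + 7/8" and U: "norm u \<le> U"
  obtains i where "\<And>n :: int. 1 / (48 * (U + 1)) \<le> \<bar>u $ i - n\<bar>"
proof -
  define d where "d = 1 / (48 * (U + 1))"
  have U0: "U \<ge> 0"
    using U norm_ge_zero[of u] by linarith
  have d: "0 < d" "d \<le> 1" "d * (2 * U + 1) < 1 / 24"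
    using U0 by (auto simp: d_def field_simps)
  have "\<exists>i. \<forall>n :: int. d \<le> \<bar>u $ i - n\<bar>"
  proof (rule ccontr)
    assume "\<not> ?thesis"
    then have "\<forall>i. \<exists>n :: int. \<bar>u $ i - n\<bar> < d"
      by (auto simp: not_le)
    then obtain n :: "3 \<Rightarrow> int" where n: "\<And>i. \<bar>u $ i - n i\<bar> < d"
      by metis
    have sq: "\<bar>(u $ i)\<^sup>2 - (n i)\<^sup>2\<bar> < 1 / 24" for i
    proof -
      have "\<bar>u $ i\<bar> \<le> U"
        using component_le_norm_cart[of u i] U by linarith
      then have "\<bar>u $ i + n i\<bar> \<le> 2 * U + 1"
        using n[of i] d(2) by linarith
      then have "\<bar>u $ i - n i\<bar> * \<bar>u $ i + n i\<bar> \<le> d * (2 * U + 1)"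
        using n[of i] d by (intro mult_mono) auto
      then show ?thesis
        using d(3) by (simp add: abs_mult[symmetric] power2_eq_square algebra_simps)
    qed
    have "(norm u)\<^sup>2 = (u $ 1)\<^sup>2 + (u $ 2)\<^sup>2 + (u $ 3)\<^sup>2"
      unfolding power2_norm_eq_inner inner_vec_def sum_3 by (simp add: power2_eq_square)
    then have "\<bar>(norm u)\<^sup>2 - of_int ((n 1)\<^sup>2 + (n 2)\<^sup>2 + (n 3)\<^sup>2)\<bar> < 1 / 8"
      using sq[of 1] sq[of 2] sq[of 3] unfolding of_int_add of_int_power by linarith
    then have "of_int N < (of_int ((n 1)\<^sup>2 + (n 2)\<^sup>2 + (n 3)\<^sup>2) :: real)"
      and "of_int ((n 1)\<^sup>2 + (n 2)\<^sup>2 + (n 3)\<^sup>2) < (of_int (N + 1) :: real)"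
      using lo hi by linarith+
    then show False
      by (simp only: of_int_less_iff)
  qed
  with that show thesis by (auto simp: d_def)
qed

text \<open>The sequence is unbounded while its increments tend to 0, so the first term to pass
  \<open>N + 1/4\<close> cannot jump over a window of length 1/2.\<close>

lemma slow_growth_hits_fractional_window:
  fixes A a :: real
  assumes "A > 0" "0 < a" "a < 1"
  obtains q N :: nat where "q \<ge> q0" "N + 1/4 \<le> A * (4 * real q + 1) powr a" "A * (4 * real q + 1) powr a \<le> N + 3/4"
proof -
  define g where "g q = A * (4 * real q + 1) powr a" for q :: nat
  have "filterlim g at_top sequentially"
    unfolding g_def using assms by real_asymp
  moreover have step: "g (Suc q) - g q \<le> 4 * A * (4 * real q + 1) powr (a - 1)" for q
  proof -
    define y where "y = 4 * real q + 1"
    have y: "y > 0" by (simp add: y_def)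
    have "4 * real (Suc q) + 1 = y * (1 + 4 / y)"
      using y by (simp add: distrib_left) (simp add: y_def)
    then have "g (Suc q) = A * (y * (1 + 4 / y)) powr a"
      by (simp only: g_def)
    also have "\<dots> = A * (y powr a * (1 + 4 / y) powr a)"
      using y by (simp add: powr_mult)
    \<comment> \<open>As the base is at least 1 and \<open>a < 1\<close>, raising the exponent to 1
      gives a linear bound for the increment.\<close>
    also have "\<dots> \<le> A * (y powr a * (1 + 4 / y) powr 1)"
      using y assms by (intro mult_left_mono powr_mono) auto
    also have "\<dots> = g q + 4 * A * (y powr a / y)"
    proof -
      have "g q = A * y powr a" by (simp add: g_def y_def)
      then show ?thesis using y by (simp add: field_simps)
    qed
    also have "y powr a / y = y powr (a - 1)"
      using y by (simp add: powr_diff)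
    finally show ?thesis by (simp add: y_def)
  qed
  have "(\<lambda>q. 4 * A * (4 * real q + 1) powr (a - 1)) \<longlonglongrightarrow> 0"
    using assms by real_asymp
  then have "eventually (\<lambda>q. 4 * A * (4 * real q + 1) powr (a - 1) < 1/2) sequentially"
    by (rule order_tendstoD) simp
  then obtain q1 where q1: "\<And>q. q \<ge> q1 \<Longrightarrow> 4 * A * (4 * real q + 1) powr (a - 1) < 1/2"
    by (auto simp: eventually_sequentially)
  define q2 where "q2 = max q0 q1"
  \<comment> \<open>With this \<open>N\<close> the term at \<open>q2\<close> is still below the
    window, so the first passage comes later and its predecessor is covered by both the minimality
    and the bound on increments.\<close>
  define N where "N = nat \<lceil>g q2\<rceil>"
  have "eventually (\<lambda>q. N + 1/4 \<le> g q) sequentially"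
    using \<open>filterlim g at_top sequentially\<close> by (simp add: filterlim_at_top)
  then obtain q3 where "N + 1/4 \<le> g q3" "q3 \<ge> q2"
    by (metis eventually_sequentially linear)
  then have ex: "\<exists>q. q \<ge> q2 \<and> N + 1/4 \<le> g q" by blast
  define q where "q = (LEAST q. q \<ge> q2 \<and> N + 1/4 \<le> g q)"
  have q: "q \<ge> q2" "N + 1/4 \<le> g q"
    using LeastI_ex[OF ex] by (auto simp: q_def)
  have gN: "g q2 \<le> N"
    by (simp add: N_def real_nat_ceiling_ge)
  with q have "q > q2"
    by (cases "q = q2") auto
  then obtain r where r: "q = Suc r" "r \<ge> q2"
    by (cases q) auto
  have "g r < N + 1/4"
    using not_less_Least[of r "\<lambda>q. q \<ge> q2 \<and> N + 1/4 \<le> g q"] r by (auto simp: q_def[symmetric])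
  moreover have "g q - g r < 1/2"
    using step[of r] q1[of r] r by (simp add: q2_def)
  ultimately have "g q \<le> N + 3/4" by linarith
  with q that[of q N] show thesis
    by (simp add: g_def q2_def)
qed

subsection \<open>Gram matrices of cubic grids\<close>

text \<open>Transfers the spectral bounds from matrix positions to an arbitrary index type, so that
  test vectors on the grid can be indexed by triples.\<close>

lemma lambda_min_spherical_gram:
  fixes x :: "'i \<Rightarrow> real ^ 3"
  assumes \<kappa>: "\<kappa> > 0" and js: "distinct js" "js \<noteq> []"
  shows lambda_min_spherical_gram_nonneg: "0 \<le> lambda_min (spherical_gram \<kappa> (map x js))"
    and lambda_min_spherical_gram_le:
      "lambda_min (spherical_gram \<kappa> (map x js)) * (\<Sum>i\<in>set js. (c i)\<^sup>2)
        \<le> (\<Sum>i\<in>set js. \<Sum>j\<in>set js. c i * c j * spherical_kernel \<kappa> (x i - x j))"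
proof -
  define n where "n = length js"
  let ?G = "spherical_gram \<kappa> (map x js)"
  have G: "?G \<in> carrier_mat n n" and n: "n > 0"
    using js by (auto simp: spherical_gram_def n_def)
  have entry: "?G $$ (i, j) = spherical_kernel \<kappa> (x (js ! i) - x (js ! j))" if "i < n" "j < n" for i j
    using that by (simp add: spherical_gram_def n_def)
  have sym: "?G $$ (i, j) = ?G $$ (j, i)" if "i < n" "j < n" for i j
    using that by (auto simp: entry spherical_kernel_def norm_minus_commute)
  have form: "(\<Sum>i<n. \<Sum>j<n. v i * v j * ?G $$ (i, j))
      = (\<Sum>i<n. \<Sum>j<n. v i * v j * spherical_kernel \<kappa> (x (js ! i) - x (js ! j)))" for v
    by (intro sum.cong refl) (simp add: entry)
  show "0 \<le> lambda_min ?G"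
    by (rule lambda_min_nonneg[OF G n sym]) (auto simp: form intro: spherical_form_nonneg[OF \<kappa>])
  have bij: "bij_betw (\<lambda>i. js ! i) {..<n} (set js)"
    using js by (intro bij_betw_nth) (auto simp: n_def)
  have reindex: "(\<Sum>i<n. g (js ! i)) = (\<Sum>i\<in>set js. g i)" for g :: "'i \<Rightarrow> real"
    by (rule sum.reindex_bij_betw[OF bij])
  have "lambda_min ?G * (\<Sum>i<n. (c (js ! i))\<^sup>2)
      \<le> (\<Sum>i<n. \<Sum>j<n. c (js ! i) * c (js ! j) * ?G $$ (i, j))"
    by (rule lambda_min_le_rayleigh[OF G n sym])
  then show "lambda_min ?G * (\<Sum>i\<in>set js. (c i)\<^sup>2)
        \<le> (\<Sum>i\<in>set js. \<Sum>j\<in>set js. c i * c j * spherical_kernel \<kappa> (x i - x j))"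
    unfolding form
    by (simp only: reindex[of "\<lambda>i. (c i)\<^sup>2"] reindex[of "\<lambda>j. c (js ! _) * c j * spherical_kernel \<kappa> (x (js ! _) - x j)"]
        reindex[of "\<lambda>i. \<Sum>j\<in>set js. c i * c j * spherical_kernel \<kappa> (x i - x j)"])
qed

section \<open>The cubic grid: separation, containment in the ball, Rayleigh quotient\<close>

definition grid_point :: "real \<Rightarrow> nat \<times> nat \<times> nat \<Rightarrow> real ^ 3" where
  "grid_point h = (\<lambda>(a, b, c). h *\<^sub>R vector [real a, real b, real c])"

definition grid_index :: "nat \<Rightarrow> (nat \<times> nat \<times> nat) list" where
  "grid_index m = List.product [0..<m] (List.product [0..<m] [0..<m])"

lemma grid_index [simp]:
  "set (grid_index m) = {..<m} \<times> {..<m} \<times> {..<m}" "distinct (grid_index m)"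
  "length (grid_index m) = m ^ 3"
  by (auto simp: grid_index_def distinct_product power3_eq_cube)

lemma grid_index_nonempty: "m > 0 \<Longrightarrow> grid_index m \<noteq> []"
  by (metis grid_index(3) length_0_conv less_numeral_extra(3) zero_less_power)

lemma norm_grid_point_diff:
  "norm (grid_point h (a, b, c) - grid_point h (a', b', c'))
    = \<bar>h\<bar> * sqrt (of_int ((int a - int a')\<^sup>2 + (int b - int b')\<^sup>2 + (int c - int c')\<^sup>2))"
proof -
  have "(norm (grid_point h (a, b, c) - grid_point h (a', b', c')))\<^sup>2
      = h\<^sup>2 * of_int ((int a - int a')\<^sup>2 + (int b - int b')\<^sup>2 + (int c - int c')\<^sup>2)"
    unfolding power2_norm_eq_inner inner_vec_def sum_3
    by (simp add: grid_point_def power2_eq_square algebra_simps)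
  then have "sqrt ((norm (grid_point h (a, b, c) - grid_point h (a', b', c')))\<^sup>2)
      = sqrt (h\<^sup>2 * of_int ((int a - int a')\<^sup>2 + (int b - int b')\<^sup>2 + (int c - int c')\<^sup>2))"
    by (simp only:)
  then show ?thesis by (simp only: real_sqrt_mult real_sqrt_abs abs_norm_cancel)
qed

text \<open>The squared distance is \<open>h\<^sup>2\<close> times a sum of three integer squares
  that do not all vanish.\<close>

lemma norm_grid_point_diff_ge:
  assumes "i \<noteq> j"
  shows "\<bar>h\<bar> \<le> norm (grid_point h i - grid_point h j)"
proof -
  obtain a b c a' b' c' where ij: "i = (a, b, c)" "j = (a', b', c')"
    by (cases i, cases j) auto
  let ?s = "(int a - int a')\<^sup>2 + (int b - int b')\<^sup>2 + (int c - int c')\<^sup>2"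
  have "(int a - int a')\<^sup>2 > 0 \<or> (int b - int b')\<^sup>2 > 0 \<or> (int c - int c')\<^sup>2 > 0"
    using assms by (auto simp: ij)
  then have "1 \<le> ?s"
    using zero_le_power2[of "int a - int a'"] zero_le_power2[of "int b - int b'"]
      zero_le_power2[of "int c - int c'"] by linarith
  then have "1 \<le> (of_int ?s :: real)"
    by (simp only: of_int_1_le_iff)
  then have "\<bar>h\<bar> * 1 \<le> \<bar>h\<bar> * sqrt (of_int ?s)"
    by (intro mult_left_mono) (simp_all only: real_sqrt_ge_1_iff abs_ge_zero)
  then show ?thesis
    by (simp only: ij norm_grid_point_diff mult_1_right)
qed

lemma inj_grid_point:
  assumes "h \<noteq> 0"
  shows "inj (grid_point h)"
proof (rule injI, rule ccontr)
  fix i j assume "grid_point h i = grid_point h j" "i \<noteq> j"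
  with norm_grid_point_diff_ge[of i j h] assms show False by simp
qed

lemma separation_grid:
  assumes h: "h > 0" and m: "m \<ge> 2"
  shows "separation (grid_point h ` set (grid_index m)) = h"
  unfolding separation_def
proof (rule Min_eqI)
  let ?X = "grid_point h ` set (grid_index m)"
  have "finite ((\<lambda>(x, y). norm (x - y)) ` (?X \<times> ?X))"
    by (intro finite_imageI finite_cartesian_product) simp_all
  then show "finite {norm (x - y) |x y. x \<in> ?X \<and> y \<in> ?X \<and> x \<noteq> y}"
    by (rule finite_subset[rotated]) auto
  show "h \<le> d" if d: "d \<in> {norm (x - y) |x y. x \<in> ?X \<and> y \<in> ?X \<and> x \<noteq> y}" for d
  proof -
    obtain x y where xy: "d = norm (x - y)" "x \<in> ?X" "y \<in> ?X" "x \<noteq> y"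
      using d by blast
    then obtain i j where "x = grid_point h i" "y = grid_point h j"
      by blast
    with xy show ?thesis
      using norm_grid_point_diff_ge[of i j h] h by auto
  qed
  have d: "norm (grid_point h (1, 0, 0) - grid_point h (0, 0, 0)) = h"
    using h by (simp add: norm_grid_point_diff)
  then have "grid_point h (1, 0, 0) \<noteq> grid_point h (0, 0, 0)"
    using h by auto
  moreover have "(1, 0, 0) \<in> set (grid_index m)" "(0, 0, 0) \<in> set (grid_index m)"
    using m by auto
  ultimately show "h \<in> {norm (x - y) |x y. x \<in> ?X \<and> y \<in> ?X \<and> x \<noteq> y}"
    using d by (intro CollectI exI[of _ "grid_point h (1, 0, 0)"] exI[of _ "grid_point h (0, 0, 0)"]) auto
qed

text \<open>The norm is at most the sum of the absolute coordinates, hence at most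
  \<open>3 * h * m\<close>.\<close>

lemma grid_point_in_cball:
  assumes h: "h \<ge> 0" and hm: "6 * h * real m \<le> 1" and i: "i \<in> set (grid_index m)"
  shows "grid_point h i \<in> cball 0 (1/2)"
proof -
  obtain a b c where i': "i = (a, b, c)" "a < m" "b < m" "c < m"
    using i by auto
  have "norm (grid_point h i) \<le> (\<Sum>k\<in>UNIV. \<bar>grid_point h i $ k\<bar>)"
    by (rule norm_le_l1_cart)
  also have "\<dots> = h * real a + h * real b + h * real c"
    unfolding sum_3 using h by (simp add: grid_point_def i' abs_mult)
  also have "\<dots> \<le> h * real m + h * real m + h * real m"
    using h i' by (intro add_mono mult_left_mono) auto
  also have "\<dots> \<le> 1 / 2"
    using hm by simp
  finally show ?thesis by simp
qed

text \<open>The test vector is the threefold tensor product of the coefficients of the fourth power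
  of a geometric sum. Near the sphere one factor of its trigonometric polynomial is off resonance
  and its square is at most \<open>(1 / \<sigma>) ^ 8\<close>, while the other two squares are at
  most \<open>(q + 1) ^ 8\<close>. Its squared length is at least
  \<open>((q + 1) ^ 8 / m) ^ 3\<close>, and the quotient of the two bounds gives the
  estimate.\<close>

lemma lambda_min_grid_le:
  fixes q N :: nat
  assumes \<kappa>: "\<kappa> > 0" and h: "h > 0"
    and lo: "N + 1/4 \<le> (\<kappa> * h / (2 * pi))\<^sup>2" and hi: "(\<kappa> * h / (2 * pi))\<^sup>2 \<le> N + 3/4"
  defines "m \<equiv> 4 * q + 1"
  shows "lambda_min (spherical_gram \<kappa> (map (grid_point h) (grid_index m)))
    \<le> 64 * (48 * (\<kappa> * h + 2)) ^ 8 / (real q + 1) ^ 5"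
proof -
  define R where "R = \<kappa> * h"
  have R: "R > 0" using \<kappa> h by (simp add: R_def)
  \<comment> \<open>The distance supplied by \<open>coordinate_far_from_int\<close> for
    \<open>U = R + 1\<close>.\<close>
  define \<sigma> where "\<sigma> = 1 / (48 * (R + 2))"
  have \<sigma>: "\<sigma> > 0" using R by (simp add: \<sigma>_def)
  \<comment> \<open>With power \<open>L\<close> the argument bounds the quotient by a constant times
    \<open>R ^ (2 * L) * q ^ (3 - 2 * L)\<close>. When \<open>R\<close> is at most of order
    \<open>sqrt q\<close>, as later, this decays only for \<open>L > 3\<close>.\<close>
  obtain b :: "nat \<Rightarrow> real" where b: "\<And>z :: complex. (\<Sum>a\<le>4 * q. b a * z ^ a) = (\<Sum>a\<le>q. z ^ a) ^ 4"
    using geometric_power_coeffs[of 4 q] by metis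
  define p where "p \<theta> = (\<Sum>a\<in>{..<m}. b a * cis (real a * \<theta>))" for \<theta>
  have p: "p \<theta> = (\<Sum>a\<le>q. cis \<theta> ^ a) ^ 4" for \<theta>
  proof -
    have m: "{..<m} = {..4 * q}" by (auto simp: m_def)
    show ?thesis
      unfolding p_def m Complex.DeMoivre[symmetric] by (rule b)
  qed
  have p_le: "(norm (p \<theta>))\<^sup>2 \<le> (real q + 1) ^ 8" for \<theta>
  proof -
    have "norm (\<Sum>a\<le>q. cis \<theta> ^ a) \<le> (\<Sum>a\<le>q. 1)"
      by (rule sum_norm_le) (simp add: norm_power)
    then have "norm (\<Sum>a\<le>q. cis \<theta> ^ a) ^ 8 \<le> (real q + 1) ^ 8"
      by (intro power_mono) simp_all
    then show ?thesis
      by (simp add: p norm_power power_mult[symmetric])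
  qed
  have p_le': "(norm (p \<theta>))\<^sup>2 \<le> (1 / \<sigma>) ^ 8" if "\<sigma> \<le> \<bar>sin (\<theta> / 2)\<bar>" for \<theta>
  proof -
    have "norm (\<Sum>a\<le>q. cis \<theta> ^ a) * \<sigma> \<le> norm (\<Sum>a\<le>q. cis \<theta> ^ a) * \<bar>sin (\<theta> / 2)\<bar>"
      using that by (intro mult_left_mono) auto
    also have "\<dots> \<le> 1" by (rule norm_geometric_cis_le)
    finally have "norm (\<Sum>a\<le>q. cis \<theta> ^ a) \<le> 1 / \<sigma>"
      using \<sigma> by (simp add: pos_le_divide_eq)
    then have "norm (\<Sum>a\<le>q. cis \<theta> ^ a) ^ 8 \<le> (1 / \<sigma>) ^ 8"
      by (intro power_mono) simp_all
    then show ?thesis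
      by (simp add: p norm_power power_mult[symmetric])
  qed
  define Z where "Z = (\<Sum>a\<in>{..<m}. (b a)\<^sup>2)"
  \<comment> \<open>At \<open>\<theta> = 0\<close> the polynomial equals \<open>(q + 1) ^ 4\<close>,
    the sum of its coefficients; Cauchy-Schwarz turns this into a lower bound for their
    squares.\<close>
  have Z: "(real q + 1) ^ 8 \<le> real m * Z"
  proof -
    have "of_real (\<Sum>a\<in>{..<m}. b a) = p 0"
      by (simp add: p_def)
    also have "\<dots> = of_real ((real q + 1) ^ 4)"
      by (simp add: p add.commute)
    finally have "(\<Sum>a\<in>{..<m}. b a) = (real q + 1) ^ 4"
      by (simp only: of_real_eq_iff)
    then have "(real q + 1) ^ 8 = (\<Sum>a\<in>{..<m}. b a)\<^sup>2"
      by (simp add: power_mult[symmetric])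
    also have "\<dots> \<le> Z * real m"
      using sum_squared_le_sum_of_squares[of b "{..<m}"] by (simp add: Z_def)
    finally show ?thesis by (simp add: mult.commute)
  qed
  define c where "c = (\<lambda>(i, j, k). b i * b j * b k)"
  let ?I = "{..<m} \<times> {..<m} \<times> {..<m}"
  have c2: "(\<Sum>i\<in>?I. (c i)\<^sup>2) = Z ^ 3"
  proof -
    have "(\<Sum>i\<in>?I. (c i)\<^sup>2) = (\<Sum>i\<in>{..<m}. \<Sum>j\<in>{..<m}. \<Sum>k\<in>{..<m}. (b i)\<^sup>2 * ((b j)\<^sup>2 * (b k)\<^sup>2))"
      by (simp add: sum.cartesian_product c_def case_prod_beta power_mult_distrib mult.assoc)
    also have "\<dots> = Z * (Z * Z)"
      by (simp only: Z_def sum_product[symmetric] sum_distrib_left[symmetric] sum_distrib_right[symmetric])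
    finally show ?thesis by (simp add: power3_eq_cube)
  qed
  have factor: "(\<Sum>i\<in>?I. c i * cis (\<xi> \<bullet> grid_point h i)) = p (h * \<xi> $ 1) * (p (h * \<xi> $ 2) * p (h * \<xi> $ 3))" for \<xi> :: "real ^ 3"
  proof -
    have "(\<Sum>i\<in>?I. c i * cis (\<xi> \<bullet> grid_point h i))
        = (\<Sum>i\<in>{..<m}. \<Sum>j\<in>{..<m}. \<Sum>k\<in>{..<m}. c (i, j, k) * cis (\<xi> \<bullet> grid_point h (i, j, k)))"
      by (simp add: sum.cartesian_product case_prod_beta)
    also have "\<dots> = (\<Sum>i\<in>{..<m}. \<Sum>j\<in>{..<m}. \<Sum>k\<in>{..<m}. (b i * cis (real i * (h * \<xi> $ 1)))
        * ((b j * cis (real j * (h * \<xi> $ 2))) * (b k * cis (real k * (h * \<xi> $ 3)))))"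
    proof (intro sum.cong refl)
      fix i j k
      have "\<xi> \<bullet> grid_point h (i, j, k) = real i * (h * \<xi> $ 1) + real j * (h * \<xi> $ 2) + real k * (h * \<xi> $ 3)"
        unfolding inner_vec_def sum_3 by (simp add: grid_point_def mult_ac)
      then show "c (i, j, k) * cis (\<xi> \<bullet> grid_point h (i, j, k)) = (b i * cis (real i * (h * \<xi> $ 1)))
        * ((b j * cis (real j * (h * \<xi> $ 2))) * (b k * cis (real k * (h * \<xi> $ 3))))"
        by (simp add: c_def cis_mult[symmetric] mult_ac)
    qed
    also have "\<dots> = p (h * \<xi> $ 1) * (p (h * \<xi> $ 2) * p (h * \<xi> $ 3))"
      by (simp only: p_def sum_product[symmetric] sum_distrib_left[symmetric] sum_distrib_right[symmetric])
    finally show ?thesis .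
  qed
  define B where "B = (1 / \<sigma>) ^ 8 * ((real q + 1) ^ 8 * (real q + 1) ^ 8)"
  \<comment> \<open>Scaled by \<open>h\<close>, the shell has thickness
    \<open>t = 1 / (2 * R + 1)\<close>. Then \<open>t * (2 * R + t) \<le> 1\<close>, so the squared
    norm of \<open>u\<close> below rises by at most 1/8 across the shell, from
    \<open>N + 3/4\<close> to \<open>N + 7/8\<close>.\<close>
  define \<epsilon> where "\<epsilon> = 1 / (h * (2 * R + 1))"
  have "\<epsilon> > 0" using h R by (simp add: \<epsilon>_def)
  have sup: "(norm (\<Sum>i\<in>?I. c i * cis (\<xi> \<bullet> grid_point h i)))\<^sup>2 \<le> B"
    if \<xi>: "\<kappa> \<le> norm \<xi>" "norm \<xi> \<le> \<kappa> + \<epsilon>" for \<xi>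
  proof -
    \<comment> \<open>In these units the period lattice of the polynomial is the integer
      lattice.\<close>
    define u where "u = (h / (2 * pi)) *\<^sub>R \<xi>"
    define t where "t = 1 / (2 * R + 1)"
    have t: "0 < t" "t \<le> 1" "t * (2 * R + 1) = 1"
      using R by (auto simp: t_def)
    have norm_u: "norm u = h * norm \<xi> / (2 * pi)"
      using h by (simp add: u_def)
    have "h * norm \<xi> \<le> h * (\<kappa> + \<epsilon>)"
      using \<xi> h by (intro mult_left_mono) auto
    also have "\<dots> = R + t"
    proof -
      have "h * \<epsilon> = t"
        using h by (simp add: \<epsilon>_def t_def)
      then show ?thesis
        by (simp add: distrib_left R_def mult.commute[of h \<kappa>])
    qed
    finally have up: "h * norm \<xi> \<le> R + t" .
    have low: "R \<le> h * norm \<xi>"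
      using \<xi> h by (simp add: R_def mult.commute)
    have "N + 1/4 \<le> (R / (2 * pi))\<^sup>2" using lo by (simp add: R_def)
    also have "\<dots> \<le> (norm u)\<^sup>2"
      unfolding norm_u using low R by (intro power_mono divide_right_mono) auto
    finally have u_lo: "of_int (int N) + 1/4 \<le> (norm u)\<^sup>2" by simp
    have "(norm u)\<^sup>2 \<le> ((R + t) / (2 * pi))\<^sup>2"
      unfolding norm_u using up low R by (intro power_mono divide_right_mono) auto
    also have "\<dots> = (R / (2 * pi))\<^sup>2 + t * (2 * R + t) / (2 * pi)\<^sup>2"
      by (simp add: power_divide power2_eq_square add_divide_distrib[symmetric] algebra_simps)
    also have "t * (2 * R + t) / (2 * pi)\<^sup>2 \<le> 1 / 8"
    proof -
      have "t * (2 * R + t) \<le> t * (2 * R + 1)"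
        using t by (intro mult_left_mono) auto
      moreover have "8 \<le> (2 * pi)\<^sup>2"
        using power_mono[of 4 "2 * pi" 2] pi_ge_two by simp
      ultimately show ?thesis
        using t by (simp add: divide_le_eq)
    qed
    also have "(R / (2 * pi))\<^sup>2 \<le> N + 3/4" using hi by (simp add: R_def)
    finally have u_hi: "(norm u)\<^sup>2 \<le> of_int (int N) + 7/8" by simp
    have "norm u \<le> R + t"
    proof -
      have "h * norm \<xi> / (2 * pi) \<le> h * norm \<xi> / 1"
        using h pi_ge_two by (intro divide_left_mono) auto
      then show ?thesis using up by (simp add: norm_u)
    qed
    then have "norm u \<le> R + 1" using t by simp
    then obtain i where i: "\<And>n :: int. 1 / (48 * ((R + 1) + 1)) \<le> \<bar>u $ i - n\<bar>"
      using coordinate_far_from_int[OF u_lo u_hi] by blast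
    have "\<sigma> = 1 / (48 * ((R + 1) + 1))"
      by (simp add: \<sigma>_def)
    then have "\<sigma> \<le> \<bar>sin (pi * u $ i)\<bar>"
      by (intro abs_sin_ge_dist_int) (simp only: i)
    also have "pi * u $ i = h * \<xi> $ i / 2"
      by (simp add: u_def)
    finally have small: "(norm (p (h * \<xi> $ i)))\<^sup>2 \<le> (1 / \<sigma>) ^ 8"
      by (rule p_le')
    \<comment> \<open>The off-resonance factor \<open>x\<close> may stand in any of the three
      positions.\<close>
    have three: "x * (y * z) \<le> s * (w * w)" "y * (x * z) \<le> s * (w * w)" "y * (z * x) \<le> s * (w * w)"
      if "0 \<le> x" "0 \<le> y" "0 \<le> z" "x \<le> s" "y \<le> w" "z \<le> w" for x y z s w :: real
    proof -
      have "x * (y * z) \<le> s * (w * w)"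
        using that by (intro mult_mono mult_nonneg_nonneg) auto
      then show "x * (y * z) \<le> s * (w * w)" "y * (x * z) \<le> s * (w * w)" "y * (z * x) \<le> s * (w * w)"
        by (simp_all add: mult_ac)
    qed
    have "(norm (p (h * \<xi> $ 1) * (p (h * \<xi> $ 2) * p (h * \<xi> $ 3))))\<^sup>2
      = (norm (p (h * \<xi> $ 1)))\<^sup>2 * ((norm (p (h * \<xi> $ 2)))\<^sup>2 * (norm (p (h * \<xi> $ 3)))\<^sup>2)"
      by (simp add: norm_mult power_mult_distrib)
    also have "\<dots> \<le> B"
      unfolding B_def using exhaust_3[of i]
    proof (elim disjE)
      assume "i = 1"
      with small show "(norm (p (h * \<xi> $ 1)))\<^sup>2 * ((norm (p (h * \<xi> $ 2)))\<^sup>2 * (norm (p (h * \<xi> $ 3)))\<^sup>2)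
        \<le> (1 / \<sigma>) ^ 8 * ((real q + 1) ^ 8 * (real q + 1) ^ 8)"
        by (intro three(1) p_le) auto
    next
      assume "i = 2"
      with small show "(norm (p (h * \<xi> $ 1)))\<^sup>2 * ((norm (p (h * \<xi> $ 2)))\<^sup>2 * (norm (p (h * \<xi> $ 3)))\<^sup>2)
        \<le> (1 / \<sigma>) ^ 8 * ((real q + 1) ^ 8 * (real q + 1) ^ 8)"
        by (intro three(2) p_le) auto
    next
      assume "i = 3"
      with small show "(norm (p (h * \<xi> $ 1)))\<^sup>2 * ((norm (p (h * \<xi> $ 2)))\<^sup>2 * (norm (p (h * \<xi> $ 3)))\<^sup>2)
        \<le> (1 / \<sigma>) ^ 8 * ((real q + 1) ^ 8 * (real q + 1) ^ 8)"
        by (intro three(3) p_le) auto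
    qed
    finally show ?thesis by (simp only: factor)
  qed
  let ?l = "lambda_min (spherical_gram \<kappa> (map (grid_point h) (grid_index m)))"
  have ne: "grid_index m \<noteq> []"
    by (intro grid_index_nonempty) (simp add: m_def)
  have "?l * Z ^ 3 \<le> (\<Sum>i\<in>?I. \<Sum>j\<in>?I. c i * c j * spherical_kernel \<kappa> (grid_point h i - grid_point h j))"
    using lambda_min_spherical_gram_le[OF \<kappa> grid_index(2) ne, of "grid_point h" c] by (simp only: grid_index(1) c2)
  also have "\<dots> \<le> B"
    by (rule spherical_form_le[OF \<kappa> \<open>\<epsilon> > 0\<close> sup])
  finally have lZ: "?l * Z ^ 3 \<le> B" .
  \<comment> \<open>The sign allows the lower bound for \<open>Z ^ 3\<close> to be multiplied by
    \<open>?l\<close>.\<close>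
  have l0: "0 \<le> ?l"
    by (rule lambda_min_spherical_gram_nonneg[OF \<kappa> grid_index(2) ne])
  define Q where "Q = real q + 1"
  have Q: "Q > 0" by (simp add: Q_def)
  have Z0: "Z \<ge> 0" by (simp add: Z_def sum_nonneg)
  have "(Q ^ 8) ^ 3 \<le> (real m * Z) ^ 3"
    using Z by (intro power_mono) (auto simp: Q_def)
  also have "\<dots> \<le> (4 * Q) ^ 3 * Z ^ 3"
    unfolding power_mult_distrib[of "real m"]
    by (intro mult_right_mono power_mono zero_le_power) (use Z0 in \<open>auto simp: Q_def m_def\<close>)
  finally have "?l * (Q ^ 8) ^ 3 \<le> ?l * ((4 * Q) ^ 3 * Z ^ 3)"
    using l0 by (rule mult_left_mono)
  also have "\<dots> = (4 * Q) ^ 3 * (?l * Z ^ 3)" by simp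
  also have "\<dots> \<le> (4 * Q) ^ 3 * B"
    using lZ Q by (intro mult_left_mono) auto
  also have "\<dots> = 64 * (1 / \<sigma>) ^ 8 / Q ^ 5 * (Q ^ 8) ^ 3"
  proof -
    define W where "W = (1 / \<sigma>) ^ 8"
    have "(4 * Q) ^ 3 * (W * (Q ^ 8 * Q ^ 8)) = 64 * W / Q ^ 5 * (Q ^ 8) ^ 3"
      using Q by (simp add: field_simps eval_nat_numeral)
    then show ?thesis
      by (simp only: B_def Q_def W_def)
  qed
  finally have "?l \<le> 64 * (1 / \<sigma>) ^ 8 / Q ^ 5"
    using Q by (simp only: mult_le_cancel_right_pos zero_less_power)
  also have "1 / \<sigma> = 48 * (\<kappa> * h + 2)"
    by (simp add: \<sigma>_def R_def)
  finally show ?thesis by (simp only: Q_def)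
qed

section \<open>Choice of the grids and passage to the limit\<close>

theorem propositionB2:
  fixes C p :: real
  assumes "C > 0" and "0 < p" and "p < 1/6"
  shows "\<exists>(X :: nat \<Rightarrow> (real ^ 3) list) (\<kappa> :: nat \<Rightarrow> real).
    (\<forall>n. distinct (X n) \<and> length (X n) \<ge> 2 \<and> set (X n) \<subseteq> cball 0 (1/2) \<and> \<kappa> n > 0) \<and>
    filterlim (\<lambda>n. length (X n)) at_top sequentially \<and>
    (\<forall>n. \<kappa> n * separation (set (X n)) = C * real (length (X n)) powr p) \<and>
    (\<lambda>n. lambda_min (spherical_gram (\<kappa> n) (X n))) \<longlonglongrightarrow> 0"
proof -
  \<comment> \<open>Chosen so that \<open>(R / (2 * pi))\<^sup>2 = A * m powr (6 * p)\<close>. The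
    exponent is below 1 by the bound on \<open>p\<close>, so the window lemma applies.\<close>
  define A where "A = (C / (2 * pi))\<^sup>2"
  have A: "A > 0" using assms by (simp add: A_def)
  have "\<forall>n :: nat. \<exists>q \<ge> Suc n. \<exists>N :: nat.
      N + 1/4 \<le> A * (4 * real q + 1) powr (6 * p) \<and> A * (4 * real q + 1) powr (6 * p) \<le> N + 3/4"
  proof
    fix n :: nat
    show "\<exists>q \<ge> Suc n. \<exists>N :: nat.
      N + 1/4 \<le> A * (4 * real q + 1) powr (6 * p) \<and> A * (4 * real q + 1) powr (6 * p) \<le> N + 3/4"
      by (rule slow_growth_hits_fractional_window[OF A, of "6 * p" "Suc n"]) (use assms in auto)
  qed
  then obtain q where q_ge: "\<And>n. q n \<ge> Suc n" and q: "\<And>n. \<exists>N :: nat. N + 1/4 \<le> A * (4 * real (q n) + 1) powr (6 * p)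
      \<and> A * (4 * real (q n) + 1) powr (6 * p) \<le> N + 3/4"
    by metis
  define m where "m n = 4 * q n + 1" for n
  define h where "h n = 1 / (6 * real (m n))" for n
  define R where "R n = C * real (m n ^ 3) powr p" for n
  \<comment> \<open>The separation is \<open>h n\<close>, so the prescribed product of wavenumber
    and separation determines the wavenumber.\<close>
  define \<kappa> where "\<kappa> n = R n / h n" for n
  define X where "X n = map (grid_point (h n)) (grid_index (m n))" for n
  have m2: "m n \<ge> 2" for n using q_ge[of n] by (simp add: m_def)
  have h: "h n > 0" for n by (simp add: h_def m_def)
  have R: "R n > 0" for n using assms by (simp add: R_def m_def)
  have \<kappa>: "\<kappa> n > 0" for n using R h by (simp add: \<kappa>_def)
  have \<kappa>h: "\<kappa> n * h n = R n" for n using h[of n] by (simp add: \<kappa>_def)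
  have R_eq: "R n = C * real (m n) powr (3 * p)" for n
  proof -
    have "real (m n ^ 3) = real (m n) powr 3" by (simp add: m_def)
    then show ?thesis by (simp only: R_def powr_powr)
  qed
  have len: "length (X n) = m n ^ 3" for n by (simp add: X_def)
  have dist: "distinct (X n)" for n
    using h[of n] inj_grid_point[of "h n"] by (auto simp: X_def distinct_map intro: inj_on_subset)
  have len2: "length (X n) \<ge> 2" for n
    using m2[of n] self_le_power[of "m n" 3] by (simp add: len)
  have ball: "set (X n) \<subseteq> cball 0 (1/2)" for n
    using grid_point_in_cball[of "h n" "m n"] h[of n] by (force simp: X_def h_def m_def)
  have sep: "\<kappa> n * separation (set (X n)) = C * real (length (X n)) powr p" for n
    by (simp only: X_def set_map separation_grid[OF h m2] \<kappa>h length_map grid_index(3) R_def)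
  have lower: "0 \<le> lambda_min (spherical_gram (\<kappa> n) (X n))" for n
    unfolding X_def using m2[of n]
    by (intro lambda_min_spherical_gram_nonneg \<kappa> grid_index_nonempty) auto
  \<comment> \<open>As \<open>3 * p < 1/2\<close>, \<open>R n + 2\<close> is at most
    \<open>(C + 2) * sqrt (m n)\<close>. With \<open>y = q n + 1\<close> its eighth power is at most
    \<open>(C + 2) ^ 8 * (4 * y) ^ 4\<close>, where 256 is \<open>4 ^ 4\<close>. One power of
    \<open>y\<close> in the denominator survives.\<close>
  define D where "D = 64 * 48 ^ 8 * (C + 2) ^ 8 * 256"
  have upper: "lambda_min (spherical_gram (\<kappa> n) (X n)) \<le> D / real (Suc n)" for n
  proof -
    obtain N :: nat where N: "N + 1/4 \<le> A * (4 * real (q n) + 1) powr (6 * p)"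
      "A * (4 * real (q n) + 1) powr (6 * p) \<le> N + 3/4"
      using q[of n] by blast
    have "(\<kappa> n * h n / (2 * pi))\<^sup>2 = A * ((real (m n) powr (3 * p)) powr 2)"
      by (simp add: \<kappa>h R_eq A_def power_mult_distrib power_divide)
    also have "\<dots> = A * (4 * real (q n) + 1) powr (6 * p)"
      by (simp add: powr_powr m_def mult_ac add_ac)
    finally have "lambda_min (spherical_gram (\<kappa> n) (X n)) \<le> 64 * (48 * (R n + 2)) ^ 8 / (real (q n) + 1) ^ 5"
      using lambda_min_grid_le[OF \<kappa> h, of N n n "q n"] N by (simp add: X_def m_def \<kappa>h)
    also have "\<dots> \<le> D / (real (q n) + 1)"
    proof -
      define y where "y = real (q n) + 1"
      have y: "y > 0" by (simp add: y_def)
      have m1: "1 \<le> real (m n)" by (simp add: m_def)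
      have "real (m n) powr (3 * p) \<le> real (m n) powr (1/2)"
        using m1 assms by (intro powr_mono) auto
      also have "\<dots> = sqrt (real (m n))" by (simp add: powr_half_sqrt)
      finally have "R n + 2 \<le> C * sqrt (real (m n)) + 2 * sqrt (real (m n))"
        using m1 assms unfolding R_eq by (intro add_mono mult_left_mono) auto
      then have "R n + 2 \<le> (C + 2) * sqrt (real (m n))"
        by (simp add: distrib_right)
      then have "(R n + 2) ^ 8 \<le> ((C + 2) * sqrt (real (m n))) ^ 8"
        using R[of n] by (intro power_mono) auto
      also have "\<dots> = (C + 2) ^ 8 * (sqrt (real (m n)) ^ 2) ^ 4"
        by (simp only: power_mult_distrib power_mult[symmetric]) simp
      also have "\<dots> = (C + 2) ^ 8 * real (m n) ^ 4"
        by simp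
      also have "\<dots> \<le> (C + 2) ^ 8 * (4 * y) ^ 4"
        using assms by (intro mult_left_mono power_mono) (auto simp: m_def y_def)
      finally have R8: "(R n + 2) ^ 8 \<le> (C + 2) ^ 8 * (4 * y) ^ 4" .
      have "64 * (48 * (R n + 2)) ^ 8 = 64 * 48 ^ 8 * (R n + 2) ^ 8"
        by (simp only: power_mult_distrib mult.assoc)
      also have "\<dots> \<le> 64 * 48 ^ 8 * ((C + 2) ^ 8 * (4 * y) ^ 4)"
        using R8 by (rule mult_left_mono) simp
      also have "\<dots> = D * y ^ 4"
        by (simp add: D_def power_mult_distrib)
      finally have "64 * (48 * (R n + 2)) ^ 8 / y ^ 5 \<le> D * y ^ 4 / y ^ 5"
        using y by (intro divide_right_mono) auto
      also have "\<dots> = D / y"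
        using y by (simp add: eval_nat_numeral)
      finally show ?thesis by (simp only: y_def)
    qed
    also have "\<dots> \<le> D / real (Suc n)"
      using q_ge[of n] assms by (intro divide_left_mono) (auto simp: D_def)
    finally show ?thesis .
  qed
  have "(\<lambda>n. D / real (Suc n)) \<longlonglongrightarrow> 0"
    by real_asymp
  then have lim: "(\<lambda>n. lambda_min (spherical_gram (\<kappa> n) (X n))) \<longlonglongrightarrow> 0"
    by (rule tendsto_sandwich[OF always_eventually always_eventually tendsto_const, rotated 2])
      (use lower upper in auto)
  have "n \<le> length (X n)" for n
    using q_ge[of n] self_le_power[of "m n" 3] m2[of n] unfolding len m_def by simp
  then have "filterlim (\<lambda>n. length (X n)) at_top sequentially"
    by (intro filterlim_at_top_mono[OF filterlim_ident] always_eventually) auto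
  then show ?thesis
    using dist len2 ball \<kappa> sep lim by blast
qed

end
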